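(* Let $q$ be a prime power, $n\ge5$ an odd integer, $m=\frac{q^n+1}{q+1}$, and let $g=\frac12(q-1)(q^{n+1}+q^n-q^2)$ be the genus of $GGS(q,n)$. For integers $s,r$ put $T(s,r)=((s-r)q+s)\frac{m-q^2+q-1}{q^3}+s-r$. Define the following sets, where $s,r,t$ range over integers (intervals $[a,b]$ with $a>b$ are empty): $$\mathcal L_1=\{-t-rm+m(q+1)s \mid s\in[0,q],\ r\in[0,s],\ t\in[0,T(s,r)]\},$$ $$\mathcal L_2=\{-t-rm+m(q+1)s \mid s\in[q+1,q^2-q],\ r\in[0,q],\ t\in[0,T(s,r)]\},$$ $$\mathcal L_3=\{-t-rm+m(q+1)s \mid s\in[q^2-q+1,q^2-2],\ r\in[0,q+s-q^2-1],\ t\in[0,m-1]\},$$ $$\mathcal L_4=\{-t-rm+m(q+1)s \mid s\in[q^2-q+1,q^2-2],\ r\in[q+s-q^2,q],\ t\in[0,T(s,r)]\},$$ $$\mathcal L_5=\{-t+m(q+1)(q^2-1) \mid t\in[q^3,m-1]\},$$ $$\mathcal L_6=\{-t-rm+m(q+1)(q^2-1) \mid r\in[1,q-2],\ t\in[0,m-1]\},$$ $$\mathcal L_7=\{-t-rm+m(q+1)(q^2-1) \mid r\in[q-1,q],\ t\in[0,T(q^2-1,r)]\}.$$ Then $$\bigcup_{i=1}^7\mathcal L_i=H(P_0)\cap\{0,\ldots,2g-1\}.$$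
   Context: For a prime power $q$ and $n$ odd, $GGS(q,n)$ is the (nonsingular model of the) curve defined by $X^q+X=Y^{q+1}$, $Y^{q^2}-Y=Z^m$ with $m=(q^n+1)/(q+1)$. It is $\mathbb F_{q^{2n}}$-maximal of genus $g=\frac12(q-1)(q^{n+1}+q^n-q^2)$ and has a unique place at infinity. $P_0=(0,0,0)$. $H(P_0)$ is the Weierstrass semigroup at $P_0$: the set of integers $r\ge0$ for which there is a function in $\mathbb F_{q^{2n}}(GGS(q,n))$ with pole divisor exactly $rP_0$. *)

theory Defs
  imports "HOL-Computational_Algebra.Polynomial" "HOL-Number_Theory.Prime_Powers"
begin

text \<open>
  The function field is the whole type \<open>'a::field\<close>; its field of constants is a subset \<open>k\<close>.
\<close>

definition is_subfield :: "'a::field set \<Rightarrow> bool" where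
  "is_subfield k \<longleftrightarrow> 0 \<in> k \<and> 1 \<in> k \<and>
     (\<forall>a\<in>k. \<forall>b\<in>k. a + b \<in> k \<and> a * b \<in> k) \<and>
     (\<forall>a\<in>k. - a \<in> k \<and> inverse a \<in> k)"

definition generated_field :: "'a::field set \<Rightarrow> 'a set" where
  "generated_field S = \<Inter> {M. is_subfield M \<and> S \<subseteq> M}"

definition transcendental_over :: "'a::field set \<Rightarrow> 'a \<Rightarrow> bool" where
  "transcendental_over k a \<longleftrightarrow>
     (\<forall>p. (\<forall>i. coeff p i \<in> k) \<and> poly p a = 0 \<longrightarrow> p = 0)"

text \<open>
  The places of the function field over \<open>k\<close>, i.e. the closed points of the nonsingular
  projective model, given by their normalized discrete valuations.  The value at \<open>0\<close>, which
  should be \<open>\<infinity>\<close>, is fixed to be \<open>0\<close>, so that each place is represented by exactly one function.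
\<close>

definition places :: "'a::field set \<Rightarrow> ('a \<Rightarrow> int) set" where
  "places k = {v.
     v 0 = 0 \<and>
     (\<forall>a b. a \<noteq> 0 \<and> b \<noteq> 0 \<longrightarrow> v (a * b) = v a + v b) \<and>
     (\<forall>a b. a \<noteq> 0 \<and> b \<noteq> 0 \<and> a + b \<noteq> 0 \<longrightarrow> v (a + b) \<ge> min (v a) (v b)) \<and>
     (\<forall>c\<in>k. c \<noteq> 0 \<longrightarrow> v c = 0) \<and>
     (\<exists>t. t \<noteq> 0 \<and> v t = 1)}"

definition pole_divisor :: "'a::field set \<Rightarrow> 'a \<Rightarrow> ('a \<Rightarrow> int) \<Rightarrow> int" where
  "pole_divisor k f = (\<lambda>P. if P \<in> places k then max 0 (- P f) else 0)"

definition weierstrass_semigroup :: "'a::field set \<Rightarrow> ('a \<Rightarrow> int) \<Rightarrow> int set" where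
  "weierstrass_semigroup k P =
     {r. r \<ge> 0 \<and> (\<exists>f. f \<noteq> 0 \<and> pole_divisor k f = (\<lambda>Q. if Q = P then r else 0))}"

text \<open>
  The affine curve \<open>X ^ q + X = Y ^ (q + 1)\<close>, \<open>Y ^ (q ^ 2) - Y = Z ^ m\<close> is absolutely irreducible, so
  its coordinate ring is a one-dimensional domain.  Every quotient of that ring by a nonzero prime
  is algebraic over \<open>k\<close>.  Hence a field generated over \<open>k\<close> by elements satisfying the two equations,
  one of them transcendental over \<open>k\<close>, is the function field of the curve, with \<open>x\<close>, \<open>y\<close>, \<open>z\<close>
  as its coordinate functions.
\<close>

definition GGS_function_field :: "nat \<Rightarrow> nat \<Rightarrow> 'a::field set \<Rightarrow> 'a \<Rightarrow> 'a \<Rightarrow> 'a \<Rightarrow> bool" where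
  "GGS_function_field q n k x y z \<longleftrightarrow>
     is_subfield k \<and> card k = q ^ (2 * n) \<and>
     generated_field (k \<union> {x, y, z}) = UNIV \<and>
     transcendental_over k x \<and>
     x ^ q + x = y ^ (q + 1) \<and>
     y ^ (q\<^sup>2) - y = z ^ ((q ^ n + 1) div (q + 1))"

text \<open>
  On the affine curve all local rings are regular, so exactly one place has its centre at the
  point \<open>(0,0,0)\<close>, i.e. has \<open>x\<close>, \<open>y\<close>, \<open>z\<close> in its maximal ideal.
\<close>

definition lies_over_origin :: "'a::field \<Rightarrow> 'a \<Rightarrow> 'a \<Rightarrow> ('a \<Rightarrow> int) \<Rightarrow> bool" where
  "lies_over_origin x y z P \<longleftrightarrow> P x > 0 \<and> P y > 0 \<and> P z > 0"

text \<open>The division by \<open>q ^ 3\<close> is exact, see \<open>GGS_T_exact\<close> below.\<close>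

definition GGS_T :: "int \<Rightarrow> int \<Rightarrow> int \<Rightarrow> int \<Rightarrow> int" where
  "GGS_T q m s r = ((s - r) * q + s) * ((m - q\<^sup>2 + q - 1) div q ^ 3) + s - r"

definition GGS_L1 :: "int \<Rightarrow> int \<Rightarrow> int set" where
  "GGS_L1 q m = {- t - r * m + m * (q + 1) * s | s r t.
     s \<in> {0..q} \<and> r \<in> {0..s} \<and> t \<in> {0..GGS_T q m s r}}"

definition GGS_L2 :: "int \<Rightarrow> int \<Rightarrow> int set" where
  "GGS_L2 q m = {- t - r * m + m * (q + 1) * s | s r t.
     s \<in> {q + 1..q\<^sup>2 - q} \<and> r \<in> {0..q} \<and> t \<in> {0..GGS_T q m s r}}"

definition GGS_L3 :: "int \<Rightarrow> int \<Rightarrow> int set" where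
  "GGS_L3 q m = {- t - r * m + m * (q + 1) * s | s r t.
     s \<in> {q\<^sup>2 - q + 1..q\<^sup>2 - 2} \<and> r \<in> {0..q + s - q\<^sup>2 - 1} \<and> t \<in> {0..m - 1}}"

definition GGS_L4 :: "int \<Rightarrow> int \<Rightarrow> int set" where
  "GGS_L4 q m = {- t - r * m + m * (q + 1) * s | s r t.
     s \<in> {q\<^sup>2 - q + 1..q\<^sup>2 - 2} \<and> r \<in> {q + s - q\<^sup>2..q} \<and> t \<in> {0..GGS_T q m s r}}"

definition GGS_L5 :: "int \<Rightarrow> int \<Rightarrow> int set" where
  "GGS_L5 q m = {- t + m * (q + 1) * (q\<^sup>2 - 1) | t. t \<in> {q ^ 3..m - 1}}"

definition GGS_L6 :: "int \<Rightarrow> int \<Rightarrow> int set" where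
  "GGS_L6 q m = {- t - r * m + m * (q + 1) * (q\<^sup>2 - 1) | r t.
     r \<in> {1..q - 2} \<and> t \<in> {0..m - 1}}"

definition GGS_L7 :: "int \<Rightarrow> int \<Rightarrow> int set" where
  "GGS_L7 q m = {- t - r * m + m * (q + 1) * (q\<^sup>2 - 1) | r t.
     r \<in> {q - 1..q} \<and> t \<in> {0..GGS_T q m (q\<^sup>2 - 1) r}}"

lemma GGS_m_exact:
  fixes q :: int
  assumes "odd n"
  shows "q + 1 dvd q ^ n + 1"
proof -
  obtain k where n: "n = 2 * k + 1" using assms by (auto elim: oddE)
  have "q + 1 dvd q ^ (2 * k + 1) + 1"
  proof (induction k)
    case (Suc k)
    have "q ^ (2 * Suc k + 1) + 1 = q\<^sup>2 * (q ^ (2 * k + 1) + 1) - (q - 1) * (q + 1)"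
      by (simp add: algebra_simps power2_eq_square)
    then show ?case using Suc by simp
  qed simp
  then show ?thesis by (simp add: n)
qed

lemma GGS_T_exact:
  fixes q m :: int
  assumes "n \<ge> 3" "m * (q + 1) = q ^ n + 1"
  shows "q ^ 3 dvd m - q\<^sup>2 + q - 1"
proof -
  have "q ^ n = q ^ 3 * q ^ (n - 3)" using assms(1) by (simp flip: power_add)
  then have "(m - q\<^sup>2 + q - 1) * (q + 1) = q ^ 3 * (q ^ (n - 3) - 1)"
    using assms(2) by (simp add: algebra_simps power2_eq_square power3_eq_cube)
  then have "q ^ 3 dvd (m - q\<^sup>2 + q - 1) * (q + 1)" by simp
  moreover have "coprime (q ^ 3) (q + 1)" by simp
  ultimately show ?thesis by (simp add: coprime_dvd_mult_left_iff)
qed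

lemma GGS_genus_exact:
  fixes q :: int
  assumes "n \<ge> 1"
  shows "2 dvd (q - 1) * (q ^ (n + 1) + q ^ n - q\<^sup>2)"
  using assms by auto

end

theory Submission
  imports Defs "HOL-Number_Theory.Cong"
begin

text \<open>
  The affine coordinate ring \<open>A\<close> has the basis \<open>x ^ a * y ^ b * z ^ c\<close> with \<open>b \<le> q\<close> and \<open>c < m\<close>.
  The orders of these monomials at the origin, \<open>m * (q + 1) * a + m * b + c\<close>, are pairwise distinct,
  and so are their pole orders at infinity, \<open>m * (q + 1) * a + m * q * b + q ^ 3 * c\<close>; hence the
  order of an element of \<open>A\<close> at either point can be read off its expansion.

  If \<open>f\<close> has its only pole at the origin, then \<open>x ^ s * f\<close> is regular on the affine curve for large
  \<open>s\<close>.  It lies in \<open>A\<close>, because \<open>A\<close> is integrally closed: \<open>A\<close> is unramified over \<open>k[z]\<close>, so modulo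
  \<open>w = z ^ (card k ^ e) - z\<close> every \<open>a \<in> A\<close> satisfies \<open>a ^ N = a\<close> for some \<open>N \<ge> 2\<close>, and \<open>w\<close> is a
  uniformizer at every prime ideal containing it.  As \<open>f\<close> has no pole at infinity, all monomials of
  \<open>x ^ s * f\<close> have pole order at most \<open>m * (q + 1) * s\<close>.  So the pole numbers at the origin are
  exactly the \<open>m * (q + 1) * s - m * r - t\<close> with \<open>m * q * r + q ^ 3 * t \<le> m * (q + 1) * s\<close>, where
  one may take \<open>r \<le> q\<close> and \<open>t < m\<close>.
\<close>

section \<open>Places\<close>

lemma is_subfieldD:
  assumes "is_subfield k"
  shows "0 \<in> k" "1 \<in> k" "a \<in> k \<Longrightarrow> b \<in> k \<Longrightarrow> a + b \<in> k" "a \<in> k \<Longrightarrow> b \<in> k \<Longrightarrow> a * b \<in> k"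
    "a \<in> k \<Longrightarrow> - a \<in> k" "a \<in> k \<Longrightarrow> inverse a \<in> k"
  using assms unfolding is_subfield_def by blast+

lemma places_zero: "v \<in> places k \<Longrightarrow> v 0 = 0"
  unfolding places_def by blast

lemma places_mult: "v \<in> places k \<Longrightarrow> a \<noteq> 0 \<Longrightarrow> b \<noteq> 0 \<Longrightarrow> v (a * b) = v a + v b"
  unfolding places_def by blast

lemma places_add:
  "v \<in> places k \<Longrightarrow> a \<noteq> 0 \<Longrightarrow> b \<noteq> 0 \<Longrightarrow> a + b \<noteq> 0 \<Longrightarrow> v (a + b) \<ge> min (v a) (v b)"
  unfolding places_def by blast

lemma places_const: "v \<in> places k \<Longrightarrow> c \<in> k \<Longrightarrow> v c = 0"
  unfolding places_def by (cases "c = 0") auto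

lemma places_one: "v \<in> places k \<Longrightarrow> v 1 = 0"
  using places_mult[of v k 1 1] by simp

lemma places_uminus: "v \<in> places k \<Longrightarrow> v (- a) = v a"
  using places_mult[of v k "-1" "-1"] places_mult[of v k "-1" a] places_one[of v k]
  by (cases "a = 0") auto

lemma places_power:
  assumes "v \<in> places k"
  shows "v (a ^ n) = int n * v a"
proof (cases "a = 0")
  case True
  then show ?thesis
    using places_zero[OF assms] places_one[OF assms] by (cases n) auto
next
  case False
  then show ?thesis
    by (induction n) (auto simp: places_one[OF assms] places_mult[OF assms] algebra_simps)
qed

lemma places_divide:
  assumes "v \<in> places k" "a \<noteq> 0" "b \<noteq> 0"
  shows "v (a / b) = v a - v b"
  using places_mult[OF assms(1), of "a / b" b] assms by simp

lemma places_add_dominant: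
  assumes v: "v \<in> places k" and a: "a \<noteq> 0" and b: "b = 0 \<or> v a < v b"
  shows "a + b \<noteq> 0" "v (a + b) = v a"
proof -
  have "a + b \<noteq> 0 \<and> v (a + b) = v a"
  proof (cases "b = 0")
    case False
    with b have lt: "v a < v b" by simp
    have nz: "a + b \<noteq> 0"
    proof
      assume "a + b = 0"
      then have "b = - a" by (simp add: eq_neg_iff_add_eq_0 add.commute)
      then show False using lt places_uminus[OF v] by simp
    qed
    have "v (a + b) \<ge> v a" using places_add[OF v a False nz] lt by simp
    moreover have "v a \<ge> min (v (a + b)) (v b)"
      using places_add[OF v nz, of "- b"] a False places_uminus[OF v, of b] by simp
    ultimately show ?thesis using nz lt by simp
  qed (use a in simp)
  then show "a + b \<noteq> 0" "v (a + b) = v a" by auto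
qed

lemma places_sum_ge:
  assumes v: "v \<in> places k" and "\<And>i. i \<in> I \<Longrightarrow> t i = 0 \<or> B \<le> v (t i)" "sum t I \<noteq> 0"
  shows "B \<le> v (sum t I)"
  using assms(2,3)
proof (induction I rule: infinite_finite_induct)
  case (insert i I)
  show ?case
  proof (cases "t i = 0 \<or> sum t I = 0")
    case True
    then show ?thesis using insert by force
  next
    case False
    then show ?thesis using insert places_add[OF v, of "t i" "sum t I"] by fastforce
  qed
qed auto

lemma places_sum_dominant:
  assumes v: "v \<in> places k" and "finite I" "i \<in> I" "t i \<noteq> 0"
    and "\<And>j. j \<in> I \<Longrightarrow> j \<noteq> i \<Longrightarrow> t j = 0 \<or> v (t i) < v (t j)"
  shows "sum t I \<noteq> 0" "v (sum t I) = v (t i)"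
proof -
  have eq: "sum t I = t i + sum t (I - {i})"
    using assms by (simp add: sum.remove)
  have "sum t (I - {i}) = 0 \<or> v (t i) < v (sum t (I - {i}))"
    using places_sum_ge[OF v, of "I - {i}" t "v (t i) + 1"] assms(5) by fastforce
  from places_add_dominant[OF v assms(4) this]
  show "sum t I \<noteq> 0" "v (sum t I) = v (t i)" by (simp_all add: eq)
qed

text \<open>A quotient \<open>a / b\<close> must get the value \<open>d a - d b\<close>, and
  additivity of \<open>d\<close> makes this independent of the representation. This produces both
  the place at infinity and the places attached to prime ideals.\<close>

lemma place_extension:
  fixes A k :: "'a::field set" and d :: "'a \<Rightarrow> int"
  assumes closed: "\<And>a b. a \<in> A \<Longrightarrow> b \<in> A \<Longrightarrow> a + b \<in> A" "\<And>a b. a \<in> A \<Longrightarrow> b \<in> A \<Longrightarrow> a * b \<in> A"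
    and k: "k \<subseteq> A" "1 \<in> k"
    and frac: "\<And>f. \<exists>a\<in>A. \<exists>b\<in>A. b \<noteq> 0 \<and> f = a / b"
    and d_mult: "\<And>a b. a \<in> A \<Longrightarrow> b \<in> A \<Longrightarrow> a \<noteq> 0 \<Longrightarrow> b \<noteq> 0 \<Longrightarrow> d (a * b) = d a + d b"
    and d_add: "\<And>a b. a \<in> A \<Longrightarrow> b \<in> A \<Longrightarrow> a \<noteq> 0 \<Longrightarrow> b \<noteq> 0 \<Longrightarrow> a + b \<noteq> 0 \<Longrightarrow>
        min (d a) (d b) \<le> d (a + b)"
    and d_const: "\<And>c. c \<in> k \<Longrightarrow> c \<noteq> 0 \<Longrightarrow> d c = 0"
    and d_unif: "\<exists>a\<in>A. \<exists>b\<in>A. a \<noteq> 0 \<and> b \<noteq> 0 \<and> d a = d b + 1"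
  obtains v where "v \<in> places k" "\<And>a. a \<in> A \<Longrightarrow> a \<noteq> 0 \<Longrightarrow> v a = d a"
proof -
  from frac have "\<forall>f. \<exists>a b. a \<in> A \<and> b \<in> A \<and> b \<noteq> 0 \<and> f = a / b" by blast
  then obtain N D where ND: "\<And>f. N f \<in> A \<and> D f \<in> A \<and> D f \<noteq> 0 \<and> f = N f / D f" by metis
  define v where "v f = (if f = 0 then 0 else d (N f) - d (D f))" for f
  have v_eq: "v (a / b) = d a - d b" if "a \<in> A" "b \<in> A" "a \<noteq> 0" "b \<noteq> 0" for a b
  proof -
    let ?f = "a / b"
    have nz: "?f \<noteq> 0" using that by simp
    have *: "N ?f \<in> A" "D ?f \<in> A" "D ?f \<noteq> 0" "?f = N ?f / D ?f" using ND[of ?f] by auto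
    then have "N ?f \<noteq> 0" using nz by (metis div_0)
    have "a * D ?f = N ?f * b" using *(3,4) that by (metis frac_eq_eq)
    then have "d a + d (D ?f) = d (N ?f) + d b"
      using d_mult * that \<open>N ?f \<noteq> 0\<close> by metis
    then show ?thesis using nz by (simp add: v_def)
  qed
  have one: "1 \<in> A" using k by auto
  have d1: "d 1 = 0" using d_const k by auto
  have vA: "v a = d a" if "a \<in> A" "a \<noteq> 0" for a
    using v_eq[OF that(1) one that(2)] d1 by simp
  have rep: "\<exists>a b. a \<in> A \<and> b \<in> A \<and> a \<noteq> 0 \<and> b \<noteq> 0 \<and> f = a / b" if "f \<noteq> 0" for f
    using frac[of f] that by force
  have "v (f * g) = v f + v g" if "f \<noteq> 0" "g \<noteq> 0" for f g
  proof -
    obtain a b where ab: "a \<in> A" "b \<in> A" "a \<noteq> 0" "b \<noteq> 0" "f = a / b" using rep \<open>f \<noteq> 0\<close> by blast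
    obtain a' b' where ab': "a' \<in> A" "b' \<in> A" "a' \<noteq> 0" "b' \<noteq> 0" "g = a' / b'"
      using rep \<open>g \<noteq> 0\<close> by blast
    have "f * g = (a * a') / (b * b')" using ab ab' by simp
    then have "v (f * g) = d (a * a') - d (b * b')"
      using v_eq[of "a * a'" "b * b'"] ab ab' closed by simp
    then show ?thesis using ab ab' d_mult v_eq by simp
  qed
  moreover have "v (f + g) \<ge> min (v f) (v g)" if "f \<noteq> 0" "g \<noteq> 0" "f + g \<noteq> 0" for f g
  proof -
    obtain a b where ab: "a \<in> A" "b \<in> A" "a \<noteq> 0" "b \<noteq> 0" "f = a / b" using rep \<open>f \<noteq> 0\<close> by blast
    obtain a' b' where ab': "a' \<in> A" "b' \<in> A" "a' \<noteq> 0" "b' \<noteq> 0" "g = a' / b'"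
      using rep \<open>g \<noteq> 0\<close> by blast
    have eq: "f + g = (a * b' + a' * b) / (b * b')" using ab ab' by (simp add: field_simps)
    then have nz: "a * b' + a' * b \<noteq> 0" using that by auto
    have "v (f + g) = d (a * b' + a' * b) - d (b * b')"
      unfolding eq by (rule v_eq) (use ab ab' closed nz in auto)
    moreover have "d (a * b' + a' * b) \<ge> min (d (a * b')) (d (a' * b))"
      by (rule d_add) (use ab ab' closed nz in auto)
    ultimately show ?thesis using ab ab' d_mult v_eq by simp
  qed
  moreover have "v c = 0" if "c \<in> k" "c \<noteq> 0" for c
    using vA[of c] d_const[of c] that k by auto
  moreover have "\<exists>t. t \<noteq> 0 \<and> v t = 1"
  proof -
    obtain a b where "a \<in> A" "b \<in> A" "a \<noteq> 0" "b \<noteq> 0" "d a = d b + 1" using d_unif by blast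
    then show ?thesis using v_eq[of a b] by (intro exI[of _ "a / b"]) auto
  qed
  moreover have "v 0 = 0" by (simp add: v_def)
  ultimately have "v \<in> places k" unfolding places_def by blast
  then show thesis using that vA by blast
qed

section \<open>Finite subfields\<close>

text \<open>Multiplication by a nonzero \<open>c\<close> permutes the nonzero elements of
  \<open>k\<close>, so comparing their products gives \<open>c ^ (card k - 1) = 1\<close>.\<close>

lemma finite_subfield_power_card:
  fixes k :: "'a::field set"
  assumes k: "is_subfield k" "finite k" and c: "c \<in> k"
  shows "c ^ card k = c"
proof (cases "c = 0")
  case True
  have "card k \<noteq> 0" using k is_subfieldD(1) by (auto simp: card_eq_0_iff)
  then show ?thesis using True by simp
next
  case False
  let ?k = "k - {0}"
  have "inj_on ((*) c) ?k" using False by (auto intro: inj_onI)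
  moreover have "(*) c ` ?k \<subseteq> ?k" using is_subfieldD(4)[OF k(1) c] False by auto
  ultimately have "(*) c ` ?k = ?k" using k(2) by (intro endo_inj_surj) auto
  then have "(\<Prod>a\<in>?k. a) = (\<Prod>a\<in>?k. c * a)"
    using prod.reindex[OF \<open>inj_on _ _\<close>, of "\<lambda>a. a"] by simp
  also have "\<dots> = c ^ card ?k * (\<Prod>a\<in>?k. a)" by (simp add: prod.distrib)
  finally have "c ^ card ?k = 1" using k(2) by (simp add: prod_zero_iff)
  moreover have "card k = Suc (card ?k)"
    using card.remove[OF k(2) is_subfieldD(1)[OF k(1)]] .
  ultimately show ?thesis by simp
qed

text \<open>Translation by 1 permutes \<open>k\<close>; comparing the sums shows that
  \<open>card k\<close> is zero in the field.\<close>

lemma finite_subfield_CHAR_dvd_card: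
  fixes k :: "'a::field set"
  assumes k: "is_subfield k" "finite k"
  shows "CHAR('a) dvd card k"
proof -
  have "inj_on ((+) 1) k" by (auto intro: inj_onI)
  moreover have "(+) 1 ` k \<subseteq> k" using is_subfieldD(2,3)[OF k(1)] by auto
  ultimately have "(+) 1 ` k = k" using k(2) by (intro endo_inj_surj)
  then have "(\<Sum>a\<in>k. a) = (\<Sum>a\<in>k. 1 + a)"
    using sum.reindex[OF \<open>inj_on _ _\<close>, of "\<lambda>a. a"] by simp
  also have "\<dots> = of_nat (card k) + (\<Sum>a\<in>k. a)" by (simp add: sum.distrib)
  finally have "of_nat (card k) = (0::'a)" by simp
  then show ?thesis by (simp add: of_nat_eq_0_iff_char_dvd)
qed

section \<open>Monomials\<close>

locale GGS_point =
  fixes q n m :: nat and k :: "'a::field set" and x y z :: 'a and P :: "'a \<Rightarrow> int"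
  assumes q_primepow: "primepow q" and n_odd: "odd n" and n_ge: "n \<ge> 3"
    and m_eq: "m = (q ^ n + 1) div (q + 1)"
    and function_field: "GGS_function_field q n k x y z"
    and P_place: "P \<in> places k" and P_origin: "lies_over_origin x y z P"
begin

section \<open>Arithmetic of \<open>q\<close> and \<open>m\<close>, and the curve equations\<close>

lemma q_ge: "q \<ge> 2"
  using primepow_gt_Suc_0[OF q_primepow] by simp

lemma m_mult: "m * (q + 1) = q ^ n + 1"
proof -
  have "int q + 1 dvd int q ^ n + 1" using GGS_m_exact n_odd by blast
  then have "int (q + 1) dvd int (q ^ n + 1)" by (simp add: add.commute)
  then have "q + 1 dvd q ^ n + 1" by (simp only: int_dvd_int_iff)
  then show ?thesis unfolding m_eq by (rule dvd_div_mult_self)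
qed

lemma m_gt: "m > 1"
proof (rule ccontr)
  assume "\<not> m > 1"
  then have "m * (q + 1) \<le> 1 * (q + 1)" by (intro mult_right_mono) auto
  moreover have "q ^ 1 < q ^ n" using q_ge n_ge by (intro power_strict_increasing) auto
  ultimately show False using m_mult by simp
qed

text \<open>A common divisor divides both \<open>q ^ n + 1\<close> and \<open>q ^ n\<close>.
  Coprimality later separates the pole orders of the monomials and supplies a uniformizer at
  infinity.\<close>

lemma m_coprime_q: "coprime m q"
proof (rule coprimeI)
  fix d assume d: "d dvd m" "d dvd q"
  then have "d dvd q ^ n + 1" using m_mult by (metis dvd_mult2)
  moreover have "d dvd q ^ n" using d(2) n_ge by (simp add: dvd_power_iff_le dvd_trans[OF _ dvd_power])
  ultimately show "is_unit d" using dvd_diff_nat[of d "q ^ n + 1" "q ^ n"] by simp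
qed

lemma k_subfield: "is_subfield k" and k_card: "card k = q ^ (2 * n)"
  and generated: "generated_field (k \<union> {x, y, z}) = UNIV"
  and x_eq: "x ^ q + x = y ^ (q + 1)" and y_eq: "y ^ (q\<^sup>2) - y = z ^ m"
  using function_field unfolding GGS_function_field_def m_eq by blast+

lemmas k_closed = is_subfieldD[OF k_subfield]

lemma k_finite: "finite k"
  using k_card q_ge by (metis card.infinite not_numeral_le_zero power_not_zero)

lemma nonzero: "x \<noteq> 0" "y \<noteq> 0" "z \<noteq> 0"
  using P_origin places_zero[OF P_place] unfolding lies_over_origin_def by auto

text \<open>The exponents are the mixed-radix digits of \<open>i = m * ((q + 1) * a + b) + c\<close>
  with \<open>b \<le> q\<close> and \<open>c < m\<close>, so every natural number indexes exactly
  one basis monomial.\<close>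

definition E :: "nat \<Rightarrow> 'a" where
  "E i = x ^ (i div (m * (q + 1))) * y ^ (i div m mod (q + 1)) * z ^ (i mod m)"

text \<open>The pole order of \<^term>\<open>E i\<close> at infinity; its order of vanishing at the origin is \<^term>\<open>i\<close>.\<close>
definition W :: "nat \<Rightarrow> nat" where
  "W i = m * (q + 1) * (i div (m * (q + 1))) + m * q * (i div m mod (q + 1)) + q ^ 3 * (i mod m)"

lemma index_parts:
  fixes a b c :: nat
  assumes "b \<le> q" "c < m"
  defines "i \<equiv> m * ((q + 1) * a + b) + c"
  shows "i div (m * (q + 1)) = a" "i div m mod (q + 1) = b" "i mod m = c"
proof -
  have "i div m = (q + 1) * a + b" using assms by simp
  moreover have "((q + 1) * a + b) div (q + 1) = a" "((q + 1) * a + b) mod (q + 1) = b"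
    using assms(1) by (simp_all only: div_mult_self4 mod_mult_self4) simp_all
  ultimately show "i div (m * (q + 1)) = a" "i div m mod (q + 1) = b"
    by (simp_all only: div_mult2_eq)
  show "i mod m = c" using assms by simp
qed

lemma E_index: "b \<le> q \<Longrightarrow> c < m \<Longrightarrow> E (m * ((q + 1) * a + b) + c) = x ^ a * y ^ b * z ^ c"
  and W_index: "b \<le> q \<Longrightarrow> c < m \<Longrightarrow>
    W (m * ((q + 1) * a + b) + c) = m * (q + 1) * a + m * q * b + q ^ 3 * c"
  unfolding E_def W_def by (simp_all only: index_parts)

lemma index_cases:
  obtains a b c where "b \<le> q" "c < m" "i = m * ((q + 1) * a + b) + c"
proof (rule that[of "i div m mod (q + 1)" "i mod m" "i div m div (q + 1)"])
  have "(q + 1) * (i div m div (q + 1)) + i div m mod (q + 1) = i div m"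
    by (rule mult_div_mod_eq)
  then show "i = m * ((q + 1) * (i div m div (q + 1)) + i div m mod (q + 1)) + i mod m"
    by (simp only: mult_div_mod_eq)
  have "i div m mod (q + 1) < q + 1" by (rule mod_less_divisor) simp
  then show "i div m mod (q + 1) \<le> q" by simp
  show "i mod m < m" using m_gt by simp
qed

text \<open>Reduction modulo \<open>m\<close> recovers \<open>c\<close>, as \<open>q ^ 3\<close> is
  a unit there; then reduction modulo \<open>q + 1\<close> recovers \<open>b\<close>, as
  \<open>q\<close> is congruent to -1.\<close>

lemma inj_W: "inj W"
proof (rule injI)
  fix i i' assume eq: "W i = W i'"
  obtain a b c where i: "b \<le> q" "c < m" "i = m * ((q + 1) * a + b) + c" by (rule index_cases)
  obtain a' b' c' where i': "b' \<le> q" "c' < m" "i' = m * ((q + 1) * a' + b') + c'" by (rule index_cases)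
  have W: "m * ((q + 1) * a + q * b) + q ^ 3 * c = m * ((q + 1) * a' + q * b') + q ^ 3 * c'"
    using eq W_index[OF i(1,2)] W_index[OF i'(1,2)] i(3) i'(3) by (simp add: algebra_simps)
  have "[q ^ 3 * c = q ^ 3 * c'] (mod m)"
    using arg_cong[OF W, of "\<lambda>t. t mod m"] by (simp add: cong_def)
  moreover have "coprime (q ^ 3) m" using m_coprime_q by (simp add: coprime_commute)
  ultimately have "[c = c'] (mod m)" using cong_mult_lcancel_nat by blast
  then have c: "c = c'" using i(2) i'(2) by (simp add: cong_def)
  with W m_gt have *: "(q + 1) * a + q * b = (q + 1) * a' + q * b'" by simp
  then have "b' + (q + 1) * (a + b) = b + (q + 1) * (a' + b')" by (simp add: algebra_simps)
  then have "(b' + (q + 1) * (a + b)) mod (q + 1) = (b + (q + 1) * (a' + b')) mod (q + 1)" by (rule arg_cong)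
  then have b: "b = b'" using i(1) i'(1) by (simp only: mod_mult_self2) simp
  with * have "(q + 1) * a = (q + 1) * a'" by simp
  then have "a = a'" by (simp only: mult_cancel1) simp
  with b c i i' show "i = i'" by simp
qed

section \<open>The filtration by pole order at infinity\<close>

text \<open>The bound is strict, so \<open>U 0\<close> is zero, \<open>U (Suc N)\<close> allows pole
  order at most \<open>N\<close>, and error terms below a leading term of weight \<open>N\<close>
  lie in \<open>U N\<close>.\<close>

definition U :: "nat \<Rightarrow> 'a set" where
  "U N = {\<Sum>i | W i < N. c i * E i | c. \<forall>i. c i \<in> k}"

lemma finite_W_less: "finite {i. W i < N}"
  using finite_vimageI[OF finite_lessThan[of N] inj_W] by (simp add: vimage_def)

lemma UI: "(\<And>i. c i \<in> k) \<Longrightarrow> (\<Sum>i | W i < N. c i * E i) \<in> U N"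
  unfolding U_def by blast

lemma UD: "a \<in> U N \<Longrightarrow> \<exists>c. (\<forall>i. c i \<in> k) \<and> a = (\<Sum>i | W i < N. c i * E i)"
  unfolding U_def by (simp add: conj_commute)

lemma U_zero: "0 \<in> U N"
  using UI[of "\<lambda>_. 0" N] k_closed(1) by simp

lemma U_0: "U 0 = {0}"
proof -
  have "a = 0" if "a \<in> U 0" for a using UD[OF that] by simp
  then show ?thesis using U_zero by blast
qed

lemma U_add:
  assumes "a \<in> U N" "b \<in> U N"
  shows "a + b \<in> U N"
proof -
  obtain c where "\<And>i. c i \<in> k" "a = (\<Sum>i | W i < N. c i * E i)" using UD[OF assms(1)] by blast
  moreover obtain d where "\<And>i. d i \<in> k" "b = (\<Sum>i | W i < N. d i * E i)" using UD[OF assms(2)] by blast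
  ultimately show ?thesis using UI[of "\<lambda>i. c i + d i" N] k_closed(3)
    by (simp add: sum.distrib algebra_simps)
qed

lemma U_scale:
  assumes "c \<in> k" "a \<in> U N"
  shows "c * a \<in> U N"
proof -
  obtain d where "\<And>i. d i \<in> k" "a = (\<Sum>i | W i < N. d i * E i)" using UD[OF assms(2)] by blast
  then show ?thesis using UI[of "\<lambda>i. c * d i" N] k_closed(4)[OF assms(1)]
    by (simp add: sum_distrib_left algebra_simps)
qed

lemma U_uminus: "a \<in> U N \<Longrightarrow> - a \<in> U N"
  using U_scale[of "-1" a N] k_closed(2,5) by simp

lemma U_sum: "(\<And>i. i \<in> I \<Longrightarrow> f i \<in> U N) \<Longrightarrow> sum f I \<in> U N"
  by (induction I rule: infinite_finite_induct) (auto simp: U_zero U_add)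

lemma U_E:
  assumes "W i < N"
  shows "E i \<in> U N"
proof -
  have "(\<Sum>j | W j < N. (if j = i then 1 else 0) * E j) = (\<Sum>j | W j < N. if j = i then E j else 0)"
    by (intro sum.cong) auto
  also have "\<dots> = E i" using assms finite_W_less by simp
  finally show ?thesis using UI[of "\<lambda>j. if j = i then 1 else 0" N] k_closed(1,2) by simp
qed

lemma U_mono:
  assumes "a \<in> U N" "N \<le> N'"
  shows "a \<in> U N'"
proof -
  from UD[OF assms(1)] obtain c where "\<forall>i. c i \<in> k" "a = (\<Sum>i | W i < N. c i * E i)" by blast
  then show ?thesis using assms(2) by (auto intro!: U_sum U_scale U_E)
qed

text \<open>Since \<open>W\<close> is injective, at most one monomial has weight exactly
  \<open>N\<close>, so each step of the filtration adds at most one dimension.\<close>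

lemma U_Suc_cases:
  assumes "a \<in> U (Suc N)"
  obtains "a \<in> U N" | i c where "W i = N" "c \<in> k" "c \<noteq> 0" "a - c * E i \<in> U N"
proof -
  obtain c where c: "\<And>i. c i \<in> k" "a = (\<Sum>i | W i < Suc N. c i * E i)"
    using UD[OF assms] by blast
  show thesis
  proof (cases "\<exists>i. W i = N \<and> c i \<noteq> 0")
    case False
    have "a = (\<Sum>i | W i < N. c i * E i)" unfolding c(2)
      by (rule sum.mono_neutral_right) (use finite_W_less[of "Suc N"] False in \<open>auto simp: less_Suc_eq\<close>)
    then show thesis using that(1) UI[of c N] c(1) by simp
  next
    case True
    then obtain i where i: "W i = N" "c i \<noteq> 0" by blast
    then have "{j. W j < Suc N} = insert i {j. W j < N}"
      using inj_W by (auto simp: less_Suc_eq dest: injD)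
    then have "a - c i * E i = (\<Sum>i | W i < N. c i * E i)"
      using i finite_W_less[of N] by (simp add: c(2))
    then show thesis using that(2)[OF i(1) c(1) i(2)] UI[of c N] c(1) by simp
  qed
qed

lemma finite_U: "finite (U N)"
proof -
  have "U N = (\<lambda>c. \<Sum>i | W i < N. c i * E i) ` (\<Pi>\<^sub>E i\<in>{i. W i < N}. k)"
  proof (intro equalityI subsetI)
    fix a assume "a \<in> U N"
    from UD[OF this] obtain c where c: "\<forall>i. c i \<in> k" "a = (\<Sum>i | W i < N. c i * E i)" by blast
    then show "a \<in> (\<lambda>c. \<Sum>i | W i < N. c i * E i) ` (\<Pi>\<^sub>E i\<in>{i. W i < N}. k)"
      by (intro image_eqI[of _ _ "restrict c {i. W i < N}"]) auto
  qed (auto intro!: U_sum U_scale U_E)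
  then show ?thesis using finite_W_less k_finite by (simp add: finite_PiE)
qed

text \<open>One new coefficient multiplies the number of elements by at most \<open>card k\<close>;
  these counts feed a pigeonhole argument below.\<close>

lemma card_U_Suc: "card (U (Suc N)) \<le> card k * card (U N)"
proof (cases "\<exists>i. W i = N")
  case True
  then obtain i where i: "W i = N" by blast
  have "U (Suc N) \<subseteq> (\<lambda>(c, a). c * E i + a) ` (k \<times> U N)"
  proof
    fix a assume "a \<in> U (Suc N)"
    then show "a \<in> (\<lambda>(c, a). c * E i + a) ` (k \<times> U N)"
    proof (cases rule: U_Suc_cases)
      case 1
      then show ?thesis using k_closed(1) by (intro image_eqI[of _ _ "(0, a)"]) auto
    next
      case (2 j c)
      then have "j = i" using i inj_W by (auto dest: injD)
      then show ?thesis using 2 by (intro image_eqI[of _ _ "(c, a - c * E i)"]) auto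
    qed
  qed
  then have "card (U (Suc N)) \<le> card ((\<lambda>(c, a). c * E i + a) ` (k \<times> U N))"
    using k_finite finite_U by (intro card_mono) auto
  also have "\<dots> \<le> card (k \<times> U N)" using k_finite finite_U by (intro card_image_le) auto
  finally show ?thesis by (simp add: card_cartesian_product)
next
  case False
  have "U (Suc N) \<subseteq> U N"
  proof
    fix a assume "a \<in> U (Suc N)"
    then show "a \<in> U N" by (cases rule: U_Suc_cases) (use False in auto)
  qed
  then have "card (U (Suc N)) \<le> card (U N)" by (intro card_mono finite_U)
  moreover have "card k \<ge> 1" using k_finite k_closed(1) by (auto simp: Suc_le_eq card_gt_0_iff)
  ultimately show ?thesis by (metis mult_1 mult_le_mono1 order_trans)
qed

lemma card_U_add: "card (U (N + c)) \<le> card k ^ c * card (U N)"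
proof (induction c)
  case (Suc c)
  have "card (U (N + Suc c)) \<le> card k * card (U (N + c))" using card_U_Suc by simp
  also have "\<dots> \<le> card k * (card k ^ c * card (U N))" using Suc by simp
  finally show ?case by (simp add: algebra_simps)
qed simp

text \<open>The curve equations replace $y^{q+1}$ and $z^m$ by monomials of the same weight,
  up to monomials of smaller weight.\<close>
lemma monomial_normal_form:
  "\<exists>i. W i = m * (q + 1) * a + m * q * b + q ^ 3 * c \<and>
     x ^ a * y ^ b * z ^ c - E i \<in> U (m * (q + 1) * a + m * q * b + q ^ 3 * c)"
proof -
  \<comment> \<open>First the exponent of \<open>y\<close> is reduced while \<open>c < m\<close>.
    Replacing \<open>y ^ (q + 1)\<close> by \<open>x ^ q + x\<close> lowers \<open>b\<close>; the
    term from \<open>x ^ q\<close> keeps the weight and the one from \<open>x\<close> has smaller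
    weight.\<close>
  have base: "\<exists>i. W i = m * (q + 1) * a + m * q * b + q ^ 3 * c \<and>
     x ^ a * y ^ b * z ^ c - E i \<in> U (m * (q + 1) * a + m * q * b + q ^ 3 * c)" if c: "c < m" for a b c
  proof (induction b arbitrary: a rule: less_induct)
    case (less b)
    show ?case
    proof (cases "b \<le> q")
      case True
      then show ?thesis using E_index[OF True c, of a] W_index[OF True c, of a] U_zero
        by (intro exI[of _ "m * ((q + 1) * a + b) + c"]) auto
    next
      case False
      define b' where "b' = b - (q + 1)"
      have b: "b = b' + (q + 1)" using False by (simp add: b'_def)
      let ?N = "m * (q + 1) * a + m * q * b + q ^ 3 * c"
      let ?N' = "m * (q + 1) * (a + 1) + m * q * b' + q ^ 3 * c"
      have N: "m * (q + 1) * (a + q) + m * q * b' + q ^ 3 * c = ?N" by (simp add: b algebra_simps)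
      have "m * (q + 1) * 1 < m * (q + 1) * q" using q_ge m_gt by (intro mult_strict_left_mono) auto
      then have N': "?N' < ?N" unfolding N[symmetric] by (simp add: algebra_simps)
      obtain i where i: "W i = ?N" "x ^ (a + q) * y ^ b' * z ^ c - E i \<in> U ?N"
        using less[of b' "a + q"] b N by auto
      obtain j where j: "W j = ?N'" "x ^ (a + 1) * y ^ b' * z ^ c - E j \<in> U ?N'"
        using less[of b' "a + 1"] b by auto
      have "x ^ a * y ^ b * z ^ c = x ^ a * y ^ b' * (x ^ q + x) * z ^ c"
        by (simp only: x_eq b power_add mult.assoc mult.left_commute)
      also have "\<dots> - E i = (x ^ (a + q) * y ^ b' * z ^ c - E i)
          + ((x ^ (a + 1) * y ^ b' * z ^ c - E j) + E j)"
        by (simp add: power_add algebra_simps)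
      also have "\<dots> \<in> U ?N"
        using i j(1) N' U_mono[OF j(2)] by (intro U_add U_E) simp_all
      finally show ?thesis using i(1) by blast
    qed
  qed
  show ?thesis
  \<comment> \<open>Replacing \<open>z ^ m\<close> by \<open>y ^ (q\<^sup>2) - y\<close> lowers
    \<open>c\<close> but raises \<open>b\<close>, so this induction keeps \<open>b\<close> arbitrary
    and falls back on \<open>base\<close> once \<open>c < m\<close>.\<close>
  proof (induction c arbitrary: b rule: less_induct)
    case (less c)
    show ?case
    proof (cases "c < m")
      case False
      define c' where "c' = c - m"
      have c: "c = c' + m" using False by (simp add: c'_def)
      have c': "c' < c" using c m_gt by simp
      let ?N = "m * (q + 1) * a + m * q * b + q ^ 3 * c"
      let ?N' = "m * (q + 1) * a + m * q * (b + 1) + q ^ 3 * c'"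
      have N: "m * (q + 1) * a + m * q * (b + q\<^sup>2) + q ^ 3 * c' = ?N"
        by (simp add: c algebra_simps power2_eq_square power3_eq_cube)
      have "1 < q\<^sup>2" using q_ge by (intro one_less_power) auto
      then have "m * q * 1 < m * q * q\<^sup>2" using q_ge m_gt by (intro mult_strict_left_mono) auto
      then have N': "?N' < ?N" unfolding N[symmetric] by (simp add: algebra_simps)
      obtain i where i: "W i = ?N" "x ^ a * y ^ (b + q\<^sup>2) * z ^ c' - E i \<in> U ?N"
        using less[OF c', of "b + q\<^sup>2"] unfolding N by blast
      obtain j where j: "W j = ?N'" "x ^ a * y ^ (b + 1) * z ^ c' - E j \<in> U ?N'"
        using less[OF c', of "b + 1"] by blast
      have "x ^ a * y ^ b * z ^ c = x ^ a * y ^ b * (y ^ q\<^sup>2 - y) * z ^ c'"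
        by (simp only: y_eq c power_add mult_ac)
      also have "\<dots> - E i = (x ^ a * y ^ (b + q\<^sup>2) * z ^ c' - E i)
          + (- (x ^ a * y ^ (b + 1) * z ^ c' - E j) + - E j)"
        by (simp add: power_add algebra_simps)
      also have "\<dots> \<in> U ?N"
        using i j N' by (intro U_add U_uminus[of "E j"] U_uminus[OF U_mono[OF j(2)]] U_E) simp_all
      finally show ?thesis using i(1) by blast
    qed (use base in blast)
  qed
qed

text \<open>Adding exponents adds weights, and the normal form has leading coefficient 1. Hence
  leading terms multiply to a leading term, which makes the degree additive.\<close>

lemma E_mult: "\<exists>l. W l = W i + W j \<and> E i * E j - E l \<in> U (W i + W j)"
proof -
  let ?a = "\<lambda>i. i div (m * (q + 1))" and ?b = "\<lambda>i. i div m mod (q + 1)" and ?c = "\<lambda>i. i mod m"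
  have "W i + W j = m * (q + 1) * (?a i + ?a j) + m * q * (?b i + ?b j) + q ^ 3 * (?c i + ?c j)"
    unfolding W_def by (simp only: distrib_left)
  moreover have "E i * E j = x ^ (?a i + ?a j) * y ^ (?b i + ?b j) * z ^ (?c i + ?c j)"
    unfolding E_def by (simp only: power_add mult_ac)
  ultimately show ?thesis using monomial_normal_form[of "?a i + ?a j" "?b i + ?b j" "?c i + ?c j"] by metis
qed

lemma U_lincomb:
  "(\<And>i. i \<in> I \<Longrightarrow> f i \<in> U N) \<Longrightarrow> (\<And>i. c i \<in> k) \<Longrightarrow> (\<Sum>i\<in>I. c i * f i) \<in> U N"
  by (intro U_sum U_scale)

text \<open>One bound is strict and the other is not: weights below \<open>N\<close> and at most
  \<open>N'\<close> add up to less than \<open>N + N'\<close>.\<close>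

lemma U_mult_aux:
  assumes "W i < N" "b \<in> U (Suc N')"
  shows "E i * b \<in> U (N + N')"
proof -
  have "E i * E j \<in> U (N + N')" if j: "W j < Suc N'" for j
  proof -
    obtain l where l: "W l = W i + W j" "E i * E j - E l \<in> U (W i + W j)" using E_mult by blast
    have "W i + W j < N + N'" using assms(1) j by simp
    then have "(E i * E j - E l) + E l \<in> U (N + N')"
      using l by (intro U_add U_E) (auto intro: U_mono[OF l(2)])
    then show ?thesis by simp
  qed
  moreover obtain c where c: "\<And>i. c i \<in> k" "b = (\<Sum>i | W i < Suc N'. c i * E i)"
    using UD[OF assms(2)] by blast
  have "E i * b = (\<Sum>j | W j < Suc N'. c j * (E i * E j))"
    unfolding c(2) sum_distrib_left by (simp only: mult_ac)
  ultimately show ?thesis using c(1) U_lincomb[of "{j. W j < Suc N'}"] by simp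
qed

lemma U_mult:
  assumes "a \<in> U N" "b \<in> U (Suc N')"
  shows "a * b \<in> U (N + N')"
proof -
  obtain c where "\<And>i. c i \<in> k" "a = (\<Sum>i | W i < N. c i * E i)"
    using UD[OF assms(1)] by blast
  then show ?thesis using U_mult_aux[OF _ assms(2)] U_lincomb[of "{i. W i < N}" "\<lambda>i. E i * b"]
    by (simp add: sum_distrib_right mult.assoc)
qed

section \<open>The affine coordinate ring and its field of fractions\<close>

definition A :: "'a set" where "A = (\<Union>N. U N)"

lemma AI: "a \<in> U N \<Longrightarrow> a \<in> A"
  unfolding A_def by blast

lemma A_add:
  assumes "a \<in> A" "b \<in> A"
  shows "a + b \<in> A"
proof -
  obtain N N' where "a \<in> U N" "b \<in> U N'" using assms unfolding A_def by blast
  then have "a + b \<in> U (max N N')" by (intro U_add) (auto intro: U_mono)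
  then show ?thesis by (rule AI)
qed

lemma A_mult:
  assumes "a \<in> A" "b \<in> A"
  shows "a * b \<in> A"
proof -
  obtain N N' where "a \<in> U N" "b \<in> U N'" using assms unfolding A_def by blast
  then have "a * b \<in> U (N + N')" by (intro U_mult) (auto intro: U_mono)
  then show ?thesis by (rule AI)
qed

lemma A_monomial: "x ^ a * y ^ b * z ^ c \<in> A"
proof -
  obtain i N where "W i = N" "x ^ a * y ^ b * z ^ c - E i \<in> U N" using monomial_normal_form by blast
  then have "(x ^ a * y ^ b * z ^ c - E i) + E i \<in> A" by (intro A_add) (auto intro: AI U_E)
  then show ?thesis by simp
qed

lemma A_gen: "x \<in> A" "y \<in> A" "z \<in> A"
  using A_monomial[of 1 0 0] A_monomial[of 0 1 0] A_monomial[of 0 0 1] by auto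

lemma A_const:
  assumes "c \<in> k"
  shows "c \<in> A"
proof -
  have "E 0 \<in> U (Suc (W 0))" by (intro U_E) simp
  then have "c * E 0 \<in> A" by (intro AI U_scale assms)
  moreover have "E 0 = 1" unfolding E_def by simp
  ultimately show ?thesis by simp
qed

lemma A_01: "0 \<in> A" "1 \<in> A"
  using A_const k_closed(1,2) by auto

lemma A_uminus: "a \<in> A \<Longrightarrow> - a \<in> A"
  using A_mult[of "-1" a] A_const[of "-1"] k_closed(2,5) by simp

lemma A_diff: "a \<in> A \<Longrightarrow> b \<in> A \<Longrightarrow> a - b \<in> A"
  using A_add[of a "- b"] A_uminus by simp

lemma A_power: "a \<in> A \<Longrightarrow> a ^ i \<in> A"
  by (induction i) (auto simp: A_01 A_mult)

lemma A_E: "E i \<in> A"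
  unfolding E_def by (rule A_monomial)

text \<open>Each element is a \<open>k\<close>-combination of monomials, so \<open>k\<close>,
  \<open>x\<close>, \<open>y\<close> and \<open>z\<close> generate \<open>A\<close> as a
  ring.\<close>

lemma A_induct [consumes 1, case_names const x y z add mult]:
  assumes a: "a \<in> A" and const: "\<And>c. c \<in> k \<Longrightarrow> Q c" and gen: "Q x" "Q y" "Q z"
    and add: "\<And>a b. a \<in> A \<Longrightarrow> b \<in> A \<Longrightarrow> Q a \<Longrightarrow> Q b \<Longrightarrow> Q (a + b)"
    and mult: "\<And>a b. a \<in> A \<Longrightarrow> b \<in> A \<Longrightarrow> Q a \<Longrightarrow> Q b \<Longrightarrow> Q (a * b)"
  shows "Q a"
proof -
  have pow: "Q (b ^ i)" if "b \<in> A" "Q b" for b i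
    using that by (induction i) (auto intro: mult A_power const k_closed)
  have E: "Q (E i)" for i
    unfolding E_def by (intro mult pow A_mult A_power A_gen gen)
  have "Q (sum f I)" if "\<And>i. i \<in> I \<Longrightarrow> f i \<in> A \<and> Q (f i)" for f and I :: "nat set"
  proof -
    have "sum f I \<in> A \<and> Q (sum f I)" using that
      by (induction I rule: infinite_finite_induct) (auto intro: add A_add const k_closed A_01)
    then show ?thesis ..
  qed
  moreover obtain N where "a \<in> U N" using a unfolding A_def by blast
  then obtain c where "\<And>i. c i \<in> k" "a = (\<Sum>i | W i < N. c i * E i)" using UD[of a N] by blast
  ultimately show ?thesis using mult const E A_E A_const A_mult by auto
qed

text \<open>The quotients form a subfield containing \<open>k\<close> and the coordinate functions,
  which generate the function field.\<close>

lemma fraction: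
  "\<exists>a\<in>A. \<exists>b\<in>A. b \<noteq> 0 \<and> f = a / b"
proof -
  let ?F = "{a / b | a b. a \<in> A \<and> b \<in> A \<and> b \<noteq> 0}"
  have A_sub: "a \<in> ?F" if "a \<in> A" for a
    using that A_01(2) by (intro CollectI exI[of _ a] exI[of _ 1]) simp_all
  have "is_subfield ?F" unfolding is_subfield_def
  proof (intro conjI ballI)
    fix f g assume "f \<in> ?F" "g \<in> ?F"
    then obtain a b a' b' where *: "a \<in> A" "b \<in> A" "b \<noteq> 0" "f = a / b"
      "a' \<in> A" "b' \<in> A" "b' \<noteq> 0" "g = a' / b'" by blast
    have "f + g = (a * b' + a' * b) / (b * b')" using * by (simp add: field_simps)
    moreover have "f * g = (a * a') / (b * b')" using * by simp
    ultimately show "f + g \<in> ?F" "f * g \<in> ?F"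
      using * A_add A_mult mult_eq_0_iff[of b b'] by blast+
  next
    fix f assume "f \<in> ?F"
    then obtain a b where *: "a \<in> A" "b \<in> A" "b \<noteq> 0" "f = a / b" by blast
    have "- f = (- a) / b" using * by simp
    then show "- f \<in> ?F" using * A_uminus by blast
    show "inverse f \<in> ?F"
    proof (cases "a = 0")
      case True
      then have "inverse f = 0" using * by simp
      then show ?thesis using A_sub[OF A_01(1)] by (simp only:)
    next
      case False
      then have "inverse f = b / a" using * by simp
      then show ?thesis using * False by blast
    qed
  qed (intro A_sub A_01)+
  moreover have "k \<union> {x, y, z} \<subseteq> ?F" using A_sub A_const A_gen by blast
  ultimately have "generated_field (k \<union> {x, y, z}) \<subseteq> ?F" unfolding generated_field_def by blast
  then show ?thesis using generated by blast
qed

section \<open>The place at the origin\<close>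

lemma places_monomial:
  assumes "v \<in> places k"
  shows "v (x ^ a * y ^ b * z ^ c) = int a * v x + int b * v y + int c * v z"
  using assms nonzero by (simp add: places_mult places_power)

lemma E_nonzero: "E i \<noteq> 0"
  unfolding E_def using nonzero by simp

text \<open>At the origin \<open>y\<close> is the term of lowest order in
  \<open>y ^ (q\<^sup>2) - y\<close>, and \<open>x\<close> is that in \<open>x ^ q + x\<close>; the
  curve equations then compare orders.\<close>

lemma origin_values:
  assumes v: "v \<in> places k" and o: "lies_over_origin x y z v"
  shows "v y = int m * v z" "v x = int (m * (q + 1)) * v z"
proof -
  have pos: "v x > 0" "v y > 0" using o unfolding lies_over_origin_def by auto
  have "1 < (int q)\<^sup>2" using q_ge by (intro one_less_power) auto
  then have "v (- y) < v (y ^ q\<^sup>2)"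
    using pos mult_strict_right_mono[of 1 "int (q\<^sup>2)" "v y"] places_power[OF v] places_uminus[OF v]
    by simp
  then have "v (- y + y ^ q\<^sup>2) = v (- y)"
    using places_add_dominant[OF v, of "- y"] nonzero by simp
  then show y: "v y = int m * v z"
    using y_eq places_power[OF v, of z m] places_uminus[OF v] by simp
  have "v x < v (x ^ q)"
    using pos q_ge mult_strict_right_mono[of 1 "int q" "v x"] places_power[OF v] by simp
  then have "v (x + x ^ q) = v x"
    using places_add_dominant[OF v, of x] nonzero by simp
  then have "v x = int (q + 1) * v y"
    using x_eq places_power[OF v, of y "q + 1"] by (simp add: add.commute)
  with y show "v x = int (m * (q + 1)) * v z" by (simp add: algebra_simps)
qed

lemma origin_E:
  assumes "v \<in> places k" "lies_over_origin x y z v"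
  shows "v (E i) = int i * v z"
proof -
  obtain a b c where i: "b \<le> q" "c < m" "i = m * ((q + 1) * a + b) + c" by (rule index_cases)
  then show ?thesis
    using E_index[OF i(1,2), of a] places_monomial[OF assms(1)] origin_values[OF assms]
    by (simp add: algebra_simps)
qed

text \<open>The orders at the origin are distinct multiples of \<open>v z > 0\<close>, so the lowest
  index with a nonzero coefficient dominates. The statement covers every place over the origin
  because uniqueness of that place is deduced from it.\<close>

lemma origin_lincomb:
  assumes v: "v \<in> places k" "lies_over_origin x y z v"
    and I: "finite I" "i \<in> I" "c i \<noteq> 0" and c: "\<And>j. c j \<in> k"
    and low: "\<And>j. j \<in> I \<Longrightarrow> j < i \<Longrightarrow> c j = 0"
  shows "(\<Sum>j\<in>I. c j * E j) \<noteq> 0" "v (\<Sum>j\<in>I. c j * E j) = int i * v z"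
proof -
  have val: "v (c j * E j) = int j * v z" if "c j \<noteq> 0" for j
    using places_mult[OF v(1) that E_nonzero] places_const[OF v(1) c] origin_E[OF v] by simp
  have "v z > 0" using v(2) unfolding lies_over_origin_def by simp
  then have dom: "c j * E j = 0 \<or> v (c i * E i) < v (c j * E j)" if "j \<in> I" "j \<noteq> i" for j
    using that low[of j] I(3) val by (cases "c j = 0"; cases "j < i") auto
  have "c i * E i \<noteq> 0" using I(3) E_nonzero by simp
  from places_sum_dominant[where t = "\<lambda>j. c j * E j", OF v(1) I(1,2) this dom]
  show "(\<Sum>j\<in>I. c j * E j) \<noteq> 0" "v (\<Sum>j\<in>I. c j * E j) = int i * v z"
    using val[OF I(3)] by auto
qed

text \<open>Otherwise the term of least index would give the sum a definite order at
  \<open>P\<close>, so that it could not vanish.\<close>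

lemma E_independent:
  assumes "finite I" "\<And>j. c j \<in> k" "(\<Sum>j\<in>I. c j * E j) = 0" "i \<in> I"
  shows "c i = 0"
proof (rule ccontr)
  assume "c i \<noteq> 0"
  define l where "l = (LEAST l. l \<in> I \<and> c l \<noteq> 0)"
  have "l \<in> I \<and> c l \<noteq> 0" unfolding l_def by (rule LeastI[of _ i]) (use assms \<open>c i \<noteq> 0\<close> in auto)
  moreover have "c j = 0" if "j \<in> I" "j < l" for j
    using that not_less_Least[of j "\<lambda>l. l \<in> I \<and> c l \<noteq> 0"] unfolding l_def by auto
  ultimately show False
    using origin_lincomb(1)[OF P_place P_origin assms(1), of l c] assms(2,3) by auto
qed

text \<open>The index \<open>i\<close> comes from the expansion alone and so serves all places over
  the origin at once. Its weight bound links the order at the origin with the pole order at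
  infinity.\<close>

lemma origin_order:
  assumes a: "a \<in> U N" "a \<noteq> 0"
  obtains i where "W i < N"
    "\<And>v. v \<in> places k \<Longrightarrow> lies_over_origin x y z v \<Longrightarrow> v a = int i * v z"
proof -
  obtain c where c: "\<And>i. c i \<in> k" "a = (\<Sum>i | W i < N. c i * E i)" using UD[OF a(1)] by blast
  define l where "l = (LEAST l. W l < N \<and> c l \<noteq> 0)"
  have "\<exists>i. W i < N \<and> c i \<noteq> 0" using a(2) unfolding c(2) by (metis (mono_tags, lifting) mem_Collect_eq mult_zero_left sum.neutral)
  then have l: "W l < N" "c l \<noteq> 0" using LeastI_ex[of "\<lambda>l. W l < N \<and> c l \<noteq> 0"] unfolding l_def by auto
  moreover have "c j = 0" if "W j < N" "j < l" for j
    using that not_less_Least[of j "\<lambda>l. W l < N \<and> c l \<noteq> 0"] unfolding l_def by auto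
  ultimately show thesis
    using that[of l] origin_lincomb(2)[OF _ _ finite_W_less, of _ l N c] c by auto
qed

text \<open>All values are multiples of \<open>v z\<close>, by the fraction representation, and a
  normalized valuation takes the value 1.\<close>

lemma origin_uniformizer:
  assumes v: "v \<in> places k" "lies_over_origin x y z v"
  shows "v z = 1"
proof -
  obtain t where t: "t \<noteq> 0" "v t = 1" using v(1) unfolding places_def by blast
  obtain a b where ab: "a \<in> A" "b \<in> A" "b \<noteq> 0" "t = a / b" using fraction by blast
  then have "a \<noteq> 0" using t by auto
  then obtain i j where "v a = int i * v z" "v b = int j * v z"
    using ab origin_order v unfolding A_def by (metis UN_E)
  then have "v z * (int i - int j) = 1"
    using places_divide[OF v(1) \<open>a \<noteq> 0\<close> ab(3)] t ab(4) by (simp add: algebra_simps)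
  moreover have "v z > 0" using v(2) unfolding lies_over_origin_def by simp
  ultimately show ?thesis by (metis pos_zmult_eq_1_iff)
qed

lemma origin_unique:
  assumes v: "v \<in> places k" "lies_over_origin x y z v"
  shows "v = P"
proof
  fix f
  have A: "v a = P a" if "a \<in> A" "a \<noteq> 0" for a
  proof -
    obtain N where "a \<in> U N" using \<open>a \<in> A\<close> unfolding A_def by blast
    then show ?thesis
      using origin_order[OF _ \<open>a \<noteq> 0\<close>] origin_uniformizer v P_place P_origin by metis
  qed
  obtain a b where ab: "a \<in> A" "b \<in> A" "b \<noteq> 0" "f = a / b" using fraction by blast
  show "v f = P f"
  proof (cases "a = 0")
    case True
    then show ?thesis using ab(4) places_zero[OF v(1)] places_zero[OF P_place] by simp
  next
    case False
    then show ?thesis using ab A places_divide[OF v(1)] places_divide[OF P_place] by simp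
  qed
qed

section \<open>The place at infinity\<close>

text \<open>This is the pole order at infinity. The successor gives constants degree 0; zero gets
  degree 0 as well.\<close>

definition deg :: "'a \<Rightarrow> nat" where "deg a = (LEAST N. a \<in> U (Suc N))"

lemma leading_notin_U:
  assumes "c \<in> k" "c \<noteq> 0"
  shows "c * E i \<notin> U (W i)"
proof
  assume "c * E i \<in> U (W i)"
  then obtain d where d: "\<And>j. d j \<in> k" "c * E i = (\<Sum>j | W j < W i. d j * E j)" using UD by blast
  let ?I = "insert i {j. W j < W i}" and ?e = "\<lambda>j. if j = i then - c else d j"
  have "(\<Sum>j\<in>?I. ?e j * E j) = - c * E i + (\<Sum>j | W j < W i. ?e j * E j)"
    using finite_W_less by simp
  also have "(\<Sum>j | W j < W i. ?e j * E j) = c * E i"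
    unfolding d(2) by (rule sum.cong) auto
  finally have "(\<Sum>j\<in>?I. ?e j * E j) = 0" by simp
  then have "?e i = 0"
    by (rule E_independent[rotated 2]) (use finite_W_less d(1) k_closed(5)[OF assms(1)] in auto)
  then show False using assms(2) by simp
qed

lemma deg_leading:
  assumes "a \<in> A" "a \<noteq> 0"
  obtains i c where "W i = deg a" "c \<in> k" "c \<noteq> 0" "a - c * E i \<in> U (deg a)"
proof -
  obtain N where "a \<in> U N" using assms unfolding A_def by blast
  then have "a \<in> U (Suc N)" by (rule U_mono) simp
  then have mem: "a \<in> U (Suc (deg a))" unfolding deg_def by (rule LeastI)
  have "a \<notin> U (deg a)"
  proof (cases "deg a")
    case 0
    then show ?thesis using assms(2) U_0 by simp
  next
    case (Suc d)
    then have "d < deg a" by simp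
    then show ?thesis using not_less_Least[of d "\<lambda>N. a \<in> U (Suc N)"] Suc unfolding deg_def by auto
  qed
  with mem that show thesis by (auto elim: U_Suc_cases)
qed

text \<open>Linear independence keeps a leading term of weight \<open>N\<close> out of
  \<open>U N\<close>, so no smaller bound fits.\<close>

lemma deg_eqI:
  assumes "W i = N" "c \<in> k" "c \<noteq> 0" "a - c * E i \<in> U N"
  shows "a \<noteq> 0" "deg a = N"
proof -
  have notin: "a \<notin> U N"
  proof
    assume "a \<in> U N"
    then have "a + - (a - c * E i) \<in> U N" using assms(4) by (intro U_add U_uminus)
    then show False using leading_notin_U[OF assms(2,3), of i] assms(1) by simp
  qed
  then show "a \<noteq> 0" using U_zero by blast
  have "(a - c * E i) + c * E i \<in> U (Suc N)"
    using assms by (intro U_add U_scale U_E U_mono[OF assms(4)]) auto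
  then show "deg a = N" unfolding deg_def
  proof (intro Least_equality)
    fix N' assume "a \<in> U (Suc N')"
    then show "N \<le> N'" using notin U_mono[of a "Suc N'" N] by (cases "N \<le> N'") auto
  qed simp
qed

lemma mem_U_Suc_deg:
  assumes "a \<in> A"
  shows "a \<in> U (Suc (deg a))"
proof -
  obtain N where "a \<in> U N" using assms unfolding A_def by blast
  then have "a \<in> U (Suc N)" by (rule U_mono) simp
  then show ?thesis unfolding deg_def by (rule LeastI)
qed

lemma deg_mult:
  assumes a: "a \<in> A" "a \<noteq> 0" and b: "b \<in> A" "b \<noteq> 0"
  shows "deg (a * b) = deg a + deg b"
proof -
  obtain i c where i: "W i = deg a" "c \<in> k" "c \<noteq> 0" "a - c * E i \<in> U (deg a)"
    using deg_leading[OF a] by blast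
  obtain j d where j: "W j = deg b" "d \<in> k" "d \<noteq> 0" "b - d * E j \<in> U (deg b)"
    using deg_leading[OF b] by blast
  obtain l where l: "W l = deg a + deg b" "E i * E j - E l \<in> U (deg a + deg b)"
    using E_mult[of i j] i(1) j(1) by auto
  have "(a - c * E i) * b \<in> U (deg a + deg b)"
    using i(4) mem_U_Suc_deg[OF b(1)] by (rule U_mult)
  moreover have "(b - d * E j) * E i \<in> U (deg b + deg a)"
    using j(4) by (rule U_mult) (simp add: U_E i(1))
  \<comment> \<open>The errors in the two factors and the error of \<open>E i * E j\<close>
    contribute only lower weight, and together they are \<open>a * b\<close> minus its leading
    term.\<close>
  ultimately have "(a - c * E i) * b + c * ((b - d * E j) * E i) + (c * d) * (E i * E j - E l)
      \<in> U (deg a + deg b)"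
    by (intro U_add U_scale[OF i(2)] U_scale[OF k_closed(4)[OF i(2) j(2)]] l(2))
      (simp_all add: add.commute)
  also have "(a - c * E i) * b + c * ((b - d * E j) * E i) + (c * d) * (E i * E j - E l)
      = a * b - (c * d) * E l" by (simp add: algebra_simps)
  finally show ?thesis using l(1) i j k_closed(4) by (intro deg_eqI(2)) auto
qed

lemma deg_add:
  assumes "a \<in> A" "b \<in> A"
  shows "deg (a + b) \<le> max (deg a) (deg b)"
proof -
  have "a + b \<in> U (Suc (max (deg a) (deg b)))"
    using mem_U_Suc_deg[OF assms(1)] mem_U_Suc_deg[OF assms(2)] by (intro U_add) (auto intro: U_mono)
  then show ?thesis unfolding deg_def by (rule Least_le)
qed

lemma deg_const:
  assumes "c \<in> k" "c \<noteq> 0"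
  shows "deg c = 0"
proof (rule deg_eqI(2)[OF _ assms])
  show "W 0 = 0" unfolding W_def by simp
  show "c - c * E 0 \<in> U 0" using U_zero unfolding E_def by simp
qed

lemma deg_monomial: "deg (x ^ a * y ^ b * z ^ c) = m * (q + 1) * a + m * q * b + q ^ 3 * c"
proof -
  obtain i where "W i = m * (q + 1) * a + m * q * b + q ^ 3 * c"
    "x ^ a * y ^ b * z ^ c - 1 * E i \<in> U (m * (q + 1) * a + m * q * b + q ^ 3 * c)"
    using monomial_normal_form[of a b c] by auto
  then show ?thesis using k_closed(2) by (intro deg_eqI(2)) auto
qed

lemma place_at_infinity:
  obtains v where "v \<in> places k" "\<And>a. a \<in> A \<Longrightarrow> a \<noteq> 0 \<Longrightarrow> v a = - int (deg a)"
proof (rule place_extension[of A k "\<lambda>a. - int (deg a)"])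
  \<comment> \<open>If \<open>m * s = q ^ 3 * t + 1\<close>, then
    \<open>y ^ s * z ^ t / x ^ s\<close> vanishes to order 1 at infinity, since the degrees of
    denominator and numerator differ by \<open>m * s - q ^ 3 * t\<close>.\<close>
  have "coprime m (q ^ 3)" using m_coprime_q by simp
  then obtain s t where st: "m * s = q ^ 3 * t + 1"
    using bezout_nat[of m "q ^ 3"] m_gt by auto
  let ?a = "x ^ 0 * y ^ s * z ^ t" and ?b = "x ^ s * y ^ 0 * z ^ 0"
  have "int (deg ?b) = int (deg ?a) + 1"
    unfolding deg_monomial using st by (simp add: algebra_simps flip: st)
  then have "- int (deg ?a) = - int (deg ?b) + 1" by simp
  moreover have "?a \<noteq> 0" "?b \<noteq> 0" using nonzero by auto
  ultimately show "\<exists>a\<in>A. \<exists>b\<in>A. a \<noteq> 0 \<and> b \<noteq> 0 \<and> - int (deg a) = - int (deg b) + 1"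
    using A_monomial[of 0 s t] A_monomial[of s 0 0] by blast
next
  fix a b assume "a \<in> A" "b \<in> A"
  then show "min (- int (deg a)) (- int (deg b)) \<le> - int (deg (a + b))"
    using deg_add[of a b] by simp
qed (use A_add A_mult A_const k_closed fraction deg_mult deg_const that in auto)

section \<open>Frobenius powers\<close>

abbreviation K :: nat where "K \<equiv> card k"

text \<open>\<open>CHAR('a)\<close> is nonzero and divides \<open>card k\<close>, a power of the
  prime below \<open>q\<close>, so it is that prime. Hence the \<open>q\<close>-power maps are
  additive.\<close>

lemma char_prime: "prime CHAR('a)" and q_char_power: "\<exists>e. q = CHAR('a) ^ e"
proof -
  obtain p e where pe: "prime p" "q = p ^ e" using q_primepow unfolding primepow_def by blast
  have dvd: "CHAR('a) dvd p ^ (e * (2 * n))"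
    using finite_subfield_CHAR_dvd_card[OF k_subfield k_finite] unfolding k_card pe(2) power_mult .
  then have "CHAR('a) > 0" using pe(1) by (metis dvd_0_left gr0I not_prime_0 power_not_zero)
  then show pr: "prime CHAR('a)" by (rule prime_CHAR_semidom)
  then have "CHAR('a) = p" using dvd pe(1) by (metis prime_dvd_power primes_dvd_imp_eq)
  then show "\<exists>e. q = CHAR('a) ^ e" using pe(2) by blast
qed

lemma frobenius_sum: "(sum f I :: 'a) ^ (q ^ i) = (\<Sum>j\<in>I. f j ^ (q ^ i))"
proof -
  obtain e where "q = CHAR('a) ^ e" using q_char_power by blast
  then have "q ^ i = CHAR('a) ^ (e * i)" by (simp add: power_mult)
  then show ?thesis by (rule freshmans_dream_sum'[OF char_prime])
qed

lemma frobenius_add: "((a::'a) + b) ^ (q ^ i) = a ^ (q ^ i) + b ^ (q ^ i)"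
proof -
  obtain e where "q = CHAR('a) ^ e" using q_char_power by blast
  then have "q ^ i = CHAR('a) ^ (e * i)" by (simp add: power_mult)
  then show ?thesis by (rule freshmans_dream'[OF char_prime])
qed

lemma frobenius_diff: "((a::'a) - b) ^ (q ^ i) = a ^ (q ^ i) - b ^ (q ^ i)"
  using frobenius_add[of "a - b" b i] by (simp add: algebra_simps)

lemma frobenius_of_nat: "(of_nat j * (a::'a)) ^ (q ^ i) = of_nat j * a ^ (q ^ i)"
  using frobenius_sum[of "\<lambda>_. a" "{..<j}" i] by simp

lemma K_power: "K ^ i = q ^ (2 * n * i)"
  by (simp add: k_card power_mult)

lemma K_power_ge: "e \<ge> 1 \<Longrightarrow> K ^ e \<ge> 2"
proof -
  assume "e \<ge> 1"
  then have "q ^ 1 \<le> q ^ (2 * n * e)" using q_ge n_ge by (intro power_increasing) auto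
  then show ?thesis unfolding K_power using q_ge by simp
qed

section \<open>Denominators\<close>

text \<open>Over an algebraic closure this is the product of \<open>z - c\<close> for
  \<open>c\<close> in the field with \<open>K ^ e\<close> elements, so its zeros in \<open>z\<close>
  are simple.\<close>

definition w :: "nat \<Rightarrow> 'a" where "w e = z ^ (K ^ e) - z"

definition dvdA :: "'a \<Rightarrow> 'a \<Rightarrow> bool" where "dvdA a b \<longleftrightarrow> (\<exists>c\<in>A. b = a * c)"

lemma w_in_A: "w e \<in> A"
  unfolding w_def by (intro A_diff A_power A_gen)

lemma w_nonzero:
  assumes "e \<ge> 1"
  shows "w e \<noteq> 0"
proof -
  have "P z > 0" using P_origin unfolding lies_over_origin_def by simp
  then have "P (- z) < P (z ^ (K ^ e))"
    using K_power_ge[OF assms] mult_strict_right_mono[of 1 "int (K ^ e)" "P z"]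
      places_power[OF P_place] places_uminus[OF P_place] by (simp del: of_nat_power)
  then have "- z + z ^ (K ^ e) \<noteq> 0"
    using places_add_dominant(1)[OF P_place, of "- z"] nonzero by simp
  then show ?thesis unfolding w_def by simp
qed

text \<open>Since \<open>w e\<close> has derivative \<open>-1\<close> in \<open>z\<close>, it divides \<open>w (e * c)\<close> exactly once.\<close>
lemma w_mult:
  assumes "e \<ge> 1" "c \<ge> 1"
  shows "\<exists>s\<in>A. w (e * c) = w e * (1 + w e * s)"
  using assms(2)
proof (induction c rule: dec_induct)
  case base
  then show ?case using A_01(1) by (intro bexI[of _ 0]) auto
next
  case (step c)
  then obtain s where s: "s \<in> A" "w (e * c) = w e * (1 + w e * s)" by blast
  have "w (e * Suc c) = (z ^ (K ^ (e * c))) ^ (K ^ e) - z"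
    unfolding w_def by (simp add: power_add mult.commute flip: power_mult)
  \<comment> \<open>The additive \<open>K ^ e\<close>-power map gives
    \<open>w (e * Suc c) = w (e * c) ^ (K ^ e) + w e\<close>; the first summand is divisible by the
    square of \<open>w e\<close> because \<open>K ^ e \<ge> 2\<close>.\<close>
  also have "\<dots> = (w (e * c) + z) ^ (K ^ e) - z" unfolding w_def by simp
  also have "\<dots> = w (e * c) ^ (K ^ e) + w e"
    unfolding K_power frobenius_add w_def by simp
  also have "w (e * c) ^ (K ^ e) = w e ^ 2 * w e ^ (K ^ e - 2) * (1 + w e * s) ^ (K ^ e)"
  proof -
    have "w e ^ (K ^ e) = w e ^ 2 * w e ^ (K ^ e - 2)"
      using K_power_ge[OF assms(1)] by (simp only: power_add[symmetric] le_add_diff_inverse)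
    then show ?thesis unfolding s(2) power_mult_distrib by (simp only:)
  qed
  finally have "w (e * Suc c) = w e * (1 + w e * (w e ^ (K ^ e - 2) * (1 + w e * s) ^ (K ^ e)))"
    by (simp add: algebra_simps power2_eq_square)
  moreover have "w e ^ (K ^ e - 2) * (1 + w e * s) ^ (K ^ e) \<in> A"
    by (intro A_mult A_power A_add A_01 w_in_A s(1))
  ultimately show ?case by blast
qed

text \<open>\<open>A\<close> modulo \<open>a\<close> has at most \<open>K\<close> to the power \<open>deg a\<close> elements, so two of the powers below agree.\<close>
lemma dvdA_diff_powers:
  assumes a: "a \<in> A" "a \<noteq> 0"
  obtains i j where "i < j" "dvdA a (z ^ (K ^ j) - z ^ (K ^ i))"
proof -
  let ?c = "deg a" and ?b = "\<lambda>i. z ^ (K ^ i)"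
  let ?L = "K ^ ?c"
  define N where "N = Suc (\<Sum>i\<le>?L. deg (?b i))"
  have b: "?b i \<in> U N" if "i \<le> ?L" for i
  proof -
    have "?b i \<in> U (Suc (deg (?b i)))" by (intro mem_U_Suc_deg A_power A_gen)
    moreover have "deg (?b i) \<le> (\<Sum>i\<le>?L. deg (?b i))" using that by (intro member_le_sum) auto
    ultimately show ?thesis unfolding N_def by (auto intro: U_mono)
  qed
  \<comment> \<open>There are \<open>Suc ?L * card (U N)\<close> pairs but at most
    \<open>?L * card (U N)\<close> values in \<open>U (N + ?c)\<close>. A collision has distinct
    \<open>i\<close>, because multiplication by \<open>a\<close> is injective.\<close>
  let ?f = "\<lambda>(i, v). ?b i + v * a"
  have sub: "?f ` ({..?L} \<times> U N) \<subseteq> U (N + ?c)"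
    using U_mono[OF b] U_mult[OF _ mem_U_Suc_deg[OF a(1)]] by (auto intro!: U_add)
  have "card (?f ` ({..?L} \<times> U N)) \<le> card (U (N + ?c))" by (intro card_mono finite_U sub)
  also have "\<dots> \<le> ?L * card (U N)" by (rule card_U_add)
  also have "\<dots> < Suc ?L * card (U N)" using finite_U U_zero by (auto simp: card_gt_0_iff)
  also have "\<dots> = card ({..?L} \<times> U N)" by (simp add: card_cartesian_product)
  finally have "\<not> inj_on ?f ({..?L} \<times> U N)" by (rule pigeonhole)
  then obtain i v i' v' where *: "v \<in> U N" "v' \<in> U N" "(i, v) \<noteq> (i', v')"
    "?b i + v * a = ?b i' + v' * a" unfolding inj_on_def by auto
  then have "i \<noteq> i'" using a(2) by auto
  have vA: "v \<in> A" "v' \<in> A" using * AI by auto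
  have "?b i - ?b i' = a * (v' - v)" "?b i' - ?b i = a * (v - v')"
    using *(4) by (simp_all add: algebra_simps)
  then have "dvdA a (?b i - ?b i')" "dvdA a (?b i' - ?b i)"
    unfolding dvdA_def using A_diff vA by blast+
  then show thesis using that[of i i'] that[of i' i] \<open>i \<noteq> i'\<close> by (cases "i < i'") auto
qed

text \<open>The difference of the two powers is \<open>w (j - i)\<close> raised to
  \<open>K ^ i\<close>. Passing to a multiple of the index reaches \<open>w\<close> at a multiple of
  the prescribed \<open>e0\<close>.\<close>

lemma dvdA_w_power:
  assumes a: "a \<in> A" "a \<noteq> 0" and e0: "e0 \<ge> 1"
  obtains e E where "e \<ge> 1" "dvdA a (w (e0 * e) ^ E)"
proof -
  obtain i j where ij: "i < j" "dvdA a (z ^ (K ^ j) - z ^ (K ^ i))" using dvdA_diff_powers[OF a] .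
  define e where "e = j - i"
  have e: "e \<ge> 1" and j: "j = e + i" using ij(1) by (auto simp: e_def)
  have "w e ^ (K ^ i) = (z ^ (K ^ e)) ^ (K ^ i) - z ^ (K ^ i)"
    unfolding w_def K_power[of i] frobenius_diff ..
  then have "dvdA a (w e ^ (K ^ i))"
    using ij(2) unfolding j by (simp add: power_add flip: power_mult)
  then obtain c where c: "c \<in> A" "w e ^ (K ^ i) = a * c" unfolding dvdA_def by blast
  obtain s where s: "s \<in> A" "w (e * e0) = w e * (1 + w e * s)" using w_mult[OF e e0] by blast
  have eq: "w (e0 * e) ^ (K ^ i) = a * (c * (1 + w e * s) ^ (K ^ i))"
    using s(2) c(2) by (simp add: mult.commute[of e0] power_mult_distrib)
  have "c * (1 + w e * s) ^ (K ^ i) \<in> A" by (intro A_mult A_power A_add A_01 w_in_A s(1) c(1))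
  with eq have "dvdA a (w (e0 * e) ^ (K ^ i))" unfolding dvdA_def by (rule bexI)
  then show thesis by (rule that[OF e])
qed

section \<open>Divisibility in the coordinate ring\<close>

lemma dvdA_zero: "dvdA a 0"
  unfolding dvdA_def using A_01(1) by (intro bexI[of _ 0]) auto

lemma dvdA_add: "dvdA a b \<Longrightarrow> dvdA a c \<Longrightarrow> dvdA a (b + c)"
  unfolding dvdA_def by (metis A_add distrib_left)

lemma dvdA_mult: "dvdA a b \<Longrightarrow> c \<in> A \<Longrightarrow> dvdA a (b * c)"
  unfolding dvdA_def by (metis A_mult mult.assoc)

lemma dvdA_imp_A: "a \<in> A \<Longrightarrow> dvdA a b \<Longrightarrow> b \<in> A"
  unfolding dvdA_def using A_mult by blast

lemma dvdA_power: "a \<in> A \<Longrightarrow> dvdA a b \<Longrightarrow> i \<ge> 1 \<Longrightarrow> dvdA a (b ^ i)"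
  using dvdA_mult[of a b "b ^ (i - 1)"] A_power[OF dvdA_imp_A, of a b]
  by (cases i) auto

lemma dvdA_sum: "(\<And>i. i \<in> I \<Longrightarrow> dvdA a (f i)) \<Longrightarrow> dvdA a (sum f I)"
  by (induction I rule: infinite_finite_induct) (auto simp: dvdA_zero dvdA_add)

section \<open>Reducedness of the fibres\<close>

text \<open>For \<open>2 * n\<close> dividing \<open>i\<close> these elements form a subring
  containing \<open>k\<close>, so a claim about all of \<open>A\<close> reduces to the generators
  \<open>x\<close>, \<open>y\<close> and \<open>z\<close>.\<close>

definition Fix :: "'a \<Rightarrow> nat \<Rightarrow> 'a set" where
  "Fix a i = {b \<in> A. dvdA a (b ^ (q ^ i) - b)}"

lemma Fix_add: "b \<in> Fix a i \<Longrightarrow> c \<in> Fix a i \<Longrightarrow> b + c \<in> Fix a i"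
  unfolding Fix_def using A_add dvdA_add[of a "b ^ q ^ i - b" "c ^ q ^ i - c"]
  by (simp add: frobenius_add algebra_simps)

lemma Fix_mult:
  assumes "b \<in> Fix a i" "c \<in> Fix a i"
  shows "b * c \<in> Fix a i"
proof -
  have "(b * c) ^ q ^ i - b * c = (b ^ q ^ i - b) * c ^ q ^ i + (c ^ q ^ i - c) * b"
    by (simp add: algebra_simps power_mult_distrib)
  then show ?thesis
    using assms dvdA_add dvdA_mult A_power unfolding Fix_def by (auto intro: A_mult)
qed

lemma Fix_const:
  assumes "c \<in> k" "2 * n dvd i"
  shows "c \<in> Fix a i"
proof -
  have "c ^ K ^ j = c" for j
    by (induction j)
      (simp_all add: power_mult finite_subfield_power_card[OF k_subfield k_finite assms(1)])
  then have "c ^ q ^ i = c" using assms(2) unfolding dvd_def K_power by auto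
  then show ?thesis unfolding Fix_def using A_const[OF assms(1)] dvdA_zero by simp
qed

lemma Fix_power: "2 * n dvd i \<Longrightarrow> b \<in> Fix a i \<Longrightarrow> b ^ j \<in> Fix a i"
  by (induction j) (auto intro: Fix_mult Fix_const k_closed)

lemma Fix_uminus: "2 * n dvd i \<Longrightarrow> b \<in> Fix a i \<Longrightarrow> - b \<in> Fix a i"
  using Fix_mult[of "-1" a i b] Fix_const[of "-1" i a] k_closed(2,5) by simp

lemma Fix_iterate:
  assumes "a \<in> A" "b \<in> Fix a i"
  shows "b \<in> Fix a (i * j)"
proof -
  have b: "b \<in> A" "dvdA a (b ^ q ^ i - b)" using assms(2) unfolding Fix_def by auto
  have "dvdA a (b ^ q ^ (i * j) - b)"
  proof (induction j)
    case (Suc j)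
    have "b ^ q ^ (i * Suc j) - b = (b ^ q ^ i - b) ^ q ^ (i * j) + (b ^ q ^ (i * j) - b)"
      unfolding frobenius_diff by (simp add: power_add flip: power_mult)
    moreover have "q ^ (i * j) \<ge> 1" using q_ge by simp
    ultimately show ?case using Suc dvdA_add dvdA_power[OF assms(1) b(2)] by metis
  qed (simp add: dvdA_zero)
  then show ?thesis unfolding Fix_def using b(1) by simp
qed

text \<open>An Artin--Schreier step: the \<open>q ^ (2 * h)\<close>-power map shifts \<open>u\<close> by an element that it
  fixes, so its \<open>p\<close>-th iterate, where \<open>p\<close> is the characteristic, fixes \<open>u\<close>.\<close>
lemma Fix_artin_schreier:
  assumes a: "a \<in> A" and u: "u \<in> A" "u ^ q\<^sup>2 = u + s" and s: "s \<in> Fix a (2 * h)"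
  shows "u \<in> Fix a (2 * h * CHAR('a))"
proof -
  \<comment> \<open>\<open>t j\<close> is the total shift of \<open>u\<close> after \<open>j\<close>
    iterations of the \<open>q\<^sup>2\<close>-power map.\<close>
  define t where "t j = (\<Sum>l<j. s ^ q ^ (2 * l))" for j
  have sA: "s \<in> A" and sfix: "dvdA a (s ^ q ^ (2 * h) - s)" using s unfolding Fix_def by auto
  have shift: "u ^ q ^ (2 * j) = u + t j" for j
  proof (induction j)
    case (Suc j)
    have "u ^ q ^ (2 * Suc j) = (u ^ q\<^sup>2) ^ q ^ (2 * j)"
      by (simp add: power_add power2_eq_square mult.assoc flip: power_mult)
    also have "\<dots> = u + t j + s ^ q ^ (2 * j)" unfolding u(2) frobenius_add Suc ..
    finally show ?case by (simp add: t_def add.assoc)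
  qed (simp add: t_def)
  have tA: "t h \<in> A" unfolding t_def
    by (induction h) (auto intro: A_01 A_add A_power sA)
  have "t h ^ q ^ (2 * h) - t h = (\<Sum>l<h. (s ^ q ^ (2 * h) - s) ^ q ^ (2 * l))"
    unfolding t_def frobenius_sum frobenius_diff sum_subtractf by (simp add: mult.commute flip: power_mult)
  moreover have "q ^ (2 * l) \<ge> 1" for l using q_ge by simp
  ultimately have tfix: "dvdA a (t h ^ q ^ (2 * h) - t h)"
    using dvdA_sum dvdA_power[OF a sfix] by metis
  \<comment> \<open>As \<open>t h\<close> is fixed modulo \<open>a\<close>, every iteration of the
    \<open>q ^ (2 * h)\<close>-power map adds another \<open>t h\<close>; after
    \<open>CHAR('a)\<close> iterations the accumulated multiple is zero.\<close>
  have "dvdA a (u ^ q ^ (2 * h * j) - (u + of_nat j * t h))" for j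
  proof (induction j)
    case (Suc j)
    let ?Q = "q ^ (2 * h)"
    have "u ^ q ^ (2 * h * Suc j) = (u ^ q ^ (2 * h * j)) ^ ?Q"
      by (simp add: power_add mult.commute flip: power_mult)
    then have "u ^ q ^ (2 * h * Suc j) - (u + of_nat (Suc j) * t h) =
      (u ^ q ^ (2 * h * j) - (u + of_nat j * t h)) ^ ?Q + (t h ^ ?Q - t h) * of_nat j"
      unfolding frobenius_diff frobenius_add frobenius_of_nat shift by (simp add: algebra_simps)
    moreover have "?Q \<ge> 1" using q_ge by simp
    moreover have "of_nat j \<in> A" by (induction j) (auto intro: A_01 A_add)
    ultimately show ?case using dvdA_add dvdA_mult[OF tfix] dvdA_power[OF a Suc] by metis
  qed (simp add: dvdA_zero)
  from this[of "CHAR('a)"] show ?thesis unfolding Fix_def using u(1) by simp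
qed

text \<open>Modulo \<open>w e\<close> the \<open>K ^ e\<close>-power map fixes \<open>z\<close>, by
  the definition of \<open>w\<close>. Then \<open>y\<close> and \<open>x\<close> follow by
  Artin-Schreier steps, each of which multiplies the number of iterations by the
  characteristic.\<close>

lemma A_power_cong:
  assumes "e \<ge> 1"
  obtains N where "N \<ge> 2" "\<And>b. b \<in> A \<Longrightarrow> dvdA (w e) (b ^ N - b)"
proof -
  let ?h = "n * e" and ?p = "CHAR('a)" and ?w = "w e"
  have p: "?p \<ge> 1" using prime_ge_1_nat[OF char_prime] .
  have z: "z \<in> Fix ?w (2 * ?h)"
    unfolding Fix_def dvdA_def using A_gen A_01
    by (auto simp: w_def K_power mult.assoc intro: bexI[of _ 1])
  have "y ^ q\<^sup>2 = y + z ^ m" using y_eq by (simp add: algebra_simps)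
  then have y: "y \<in> Fix ?w (2 * ?h * ?p)"
    by (rule Fix_artin_schreier[OF w_in_A A_gen(2)]) (rule Fix_power[OF _ z], simp)
  then have y': "y \<in> Fix ?w (2 * (?h * ?p))" by (simp add: mult.assoc)
  \<comment> \<open>Substituting \<open>x ^ q = y ^ (q + 1) - x\<close> twice gives
    \<open>x ^ q\<^sup>2 = x + ?s\<close>, the shape required for the Artin-Schreier step.\<close>
  let ?s = "y ^ (q * (q + 1)) + - (y ^ (q + 1))"
  have xq: "x ^ q = y ^ (q + 1) - x" using x_eq by (simp add: eq_diff_eq)
  have "x ^ q\<^sup>2 = (x ^ q) ^ q" by (simp add: power2_eq_square power_mult)
  also have "\<dots> = (y ^ (q + 1) - x) ^ q" by (simp only: xq)
  also have "\<dots> = (y ^ (q + 1)) ^ q - x ^ q"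
    using frobenius_diff[of "y ^ (q + 1)" x 1] by (simp only: power_one_right)
  also have "\<dots> = x + ?s"
    unfolding xq power_mult[symmetric] mult.commute[of "q + 1"] by (simp del: power_Suc add: algebra_simps)
  finally have x: "x \<in> Fix ?w (2 * (?h * ?p) * ?p)"
    by (rule Fix_artin_schreier[OF w_in_A A_gen(1)])
      (intro Fix_add Fix_uminus Fix_power[OF _ y'], simp_all)
  let ?i = "2 * ?h * ?p * ?p"
  have "b \<in> Fix ?w ?i" if "b \<in> A" for b
    using that
  proof (induction b rule: A_induct)
    case x
    then show ?case using \<open>x \<in> _\<close> by (simp add: mult.assoc)
  next
    case y
    then show ?case using \<open>y \<in> Fix ?w (2 * ?h * ?p)\<close> by (rule Fix_iterate[OF w_in_A])
  next
    case z
    then show ?case using Fix_iterate[OF w_in_A \<open>z \<in> _\<close>, of "?p * ?p"] by (simp add: mult.assoc)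
  qed (auto intro: Fix_add Fix_mult Fix_const)
  moreover have "q ^ ?i \<ge> q ^ 1" using q_ge n_ge assms p by (intro power_increasing) auto
  ultimately show thesis using that[of "q ^ ?i"] q_ge unfolding Fix_def by auto
qed

section \<open>Places of the affine curve\<close>

definition idealA :: "'a set \<Rightarrow> bool" where
  "idealA I \<longleftrightarrow> I \<subseteq> A \<and> 0 \<in> I \<and> (\<forall>b\<in>I. \<forall>c\<in>I. b + c \<in> I) \<and> (\<forall>b\<in>A. \<forall>c\<in>I. b * c \<in> I)"

lemma idealAD:
  assumes "idealA I"
  shows "I \<subseteq> A" "0 \<in> I" "b \<in> I \<Longrightarrow> c \<in> I \<Longrightarrow> b + c \<in> I" "b \<in> A \<Longrightarrow> c \<in> I \<Longrightarrow> b * c \<in> I"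
    "b \<in> I \<Longrightarrow> c \<in> A \<Longrightarrow> b * c \<in> I" "b \<in> I \<Longrightarrow> c \<in> I \<Longrightarrow> b - c \<in> I"
proof -
  have *: "I \<subseteq> A" "0 \<in> I" "\<And>b c. b \<in> I \<Longrightarrow> c \<in> I \<Longrightarrow> b + c \<in> I"
    "\<And>b c. b \<in> A \<Longrightarrow> c \<in> I \<Longrightarrow> b * c \<in> I"
    using assms unfolding idealA_def by auto
  show "I \<subseteq> A" "0 \<in> I" "b \<in> I \<Longrightarrow> c \<in> I \<Longrightarrow> b + c \<in> I" using * by auto
  show "b \<in> A \<Longrightarrow> c \<in> I \<Longrightarrow> b * c \<in> I" by (rule *(4))
  show "b \<in> I \<Longrightarrow> c \<in> A \<Longrightarrow> b * c \<in> I" using *(4)[of c b] by (simp only: mult.commute[of b c])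
  show "b \<in> I \<Longrightarrow> c \<in> I \<Longrightarrow> b - c \<in> I"
    using *(3)[of b "- c"] *(4)[of "-1" c] A_uminus[OF A_01(2)] by simp
qed

text \<open>Zorn's lemma gives an ideal \<open>M\<close> maximal among those containing
  \<open>\<pi>\<close> and avoiding \<open>a\<close>. Two elements outside \<open>M\<close> with
  product in \<open>M\<close> would give \<open>a\<^sup>2 \<in> M\<close>, hence
  \<open>a ^ N \<in> M\<close>, and the congruence would put \<open>a\<close> into
  \<open>M\<close>.\<close>

lemma prime_ideal_avoiding:
  assumes pi: "\<pi> \<in> A" and a: "a \<in> A" "\<not> dvdA \<pi> a" and N: "N \<ge> 2" "dvdA \<pi> (a ^ N - a)"
  obtains M where "idealA M" "\<pi> \<in> M" "a \<notin> M"
    "\<And>b c. b \<in> A \<Longrightarrow> c \<in> A \<Longrightarrow> b * c \<in> M \<Longrightarrow> b \<in> M \<or> c \<in> M"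
proof -
  let ?S = "{I. idealA I \<and> \<pi> \<in> I \<and> a \<notin> I}"
  have "{b. dvdA \<pi> b} \<in> ?S"
  proof -
    have "dvdA \<pi> (b * c)" if "b \<in> A" "dvdA \<pi> c" for b c
      using dvdA_mult[OF that(2,1)] by (simp only: mult.commute)
    then have "idealA {b. dvdA \<pi> b}"
      unfolding idealA_def using dvdA_imp_A[OF pi] dvdA_zero dvdA_add by auto
    moreover have "dvdA \<pi> \<pi>" unfolding dvdA_def using A_01(2) by (intro bexI[of _ 1]) auto
    ultimately show ?thesis using a(2) by simp
  qed
  moreover have "\<Union>C \<in> ?S" if "C \<noteq> {}" and C: "subset.chain ?S C" for C
  proof -
    have C': "idealA I \<and> \<pi> \<in> I \<and> a \<notin> I" if "I \<in> C" for I
      using C that unfolding subset.chain_def by auto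
    have "b + c \<in> \<Union>C" if bc: "b \<in> \<Union>C" "c \<in> \<Union>C" for b c
    proof -
      obtain I J where IJ: "I \<in> C" "b \<in> I" "J \<in> C" "c \<in> J" using bc by blast
      then have "I \<subseteq> J \<or> J \<subseteq> I" using C unfolding subset.chain_def by blast
      then show ?thesis
      proof
        assume "I \<subseteq> J"
        then show ?thesis using IJ C' idealAD(3) by blast
      next
        assume "J \<subseteq> I"
        then show ?thesis using IJ C' idealAD(3) by blast
      qed
    qed
    moreover have "\<Union>C \<subseteq> A" using C' idealAD(1) by blast
    moreover have "0 \<in> \<Union>C" "\<pi> \<in> \<Union>C" "a \<notin> \<Union>C" using C' idealAD(2) \<open>C \<noteq> {}\<close> by blast+
    moreover have "b * c \<in> \<Union>C" if "b \<in> A" "c \<in> \<Union>C" for b c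
      using that C' idealAD(4) by blast
    ultimately show ?thesis unfolding idealA_def by blast
  qed
  ultimately obtain M where M: "M \<in> ?S" "\<forall>X\<in>?S. M \<subseteq> X \<longrightarrow> X = M"
    using subset_Zorn_nonempty[of ?S] by blast
  then have id: "idealA M" and wM: "\<pi> \<in> M" and aM: "a \<notin> M" by auto
  have adjoin: "\<exists>r\<in>M. \<exists>u\<in>A. a = r + b * u" if b: "b \<in> A" "b \<notin> M" for b
  proof -
    let ?X = "{r + b * u | r u. r \<in> M \<and> u \<in> A}"
    have "idealA ?X" unfolding idealA_def
    proof (intro conjI ballI)
      show "?X \<subseteq> A" using idealAD(1)[OF id] b A_add A_mult by blast
      show "0 \<in> ?X" using idealAD(2)[OF id] A_01(1) by (intro CollectI exI[of _ 0]) auto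
    next
      fix c d assume "c \<in> ?X" "d \<in> ?X"
      then obtain r u r' u' where *: "r \<in> M" "u \<in> A" "r' \<in> M" "u' \<in> A" "c = r + b * u" "d = r' + b * u'"
        by blast
      then have "c + d = (r + r') + b * (u + u')" by (simp add: algebra_simps)
      then show "c + d \<in> ?X" using * idealAD(3)[OF id] A_add by blast
    next
      fix c d assume "c \<in> A" "d \<in> ?X"
      then obtain r u where *: "r \<in> M" "u \<in> A" "d = r + b * u" by blast
      then have "c * d = c * r + b * (c * u)" by (simp add: algebra_simps)
      then show "c * d \<in> ?X" using * \<open>c \<in> A\<close> idealAD(4)[OF id] A_mult by blast
    qed
    moreover have sub: "M \<subseteq> ?X"
    proof
      fix r assume "r \<in> M"
      then show "r \<in> ?X" using A_01(1) by (intro CollectI exI[of _ r] exI[of _ 0]) auto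
    qed
    moreover have "b \<in> ?X" using idealAD(2)[OF id] A_01(2)
      by (intro CollectI exI[of _ 0] exI[of _ 1]) auto
    ultimately have "a \<in> ?X" using M(2) b(2) wM by blast
    then show ?thesis by blast
  qed
  have "b \<in> M \<or> c \<in> M" if bc: "b \<in> A" "c \<in> A" "b * c \<in> M" for b c
  proof (rule ccontr)
    assume "\<not> ?thesis"
    then obtain r u r' u' where *: "r \<in> M" "u \<in> A" "r' \<in> M" "u' \<in> A" "a = r + b * u" "a = r' + c * u'"
      using adjoin bc(1,2) by metis
    have "a\<^sup>2 = (r + b * u) * (r' + c * u')" by (simp only: power2_eq_square flip: *(5,6))
    also have "\<dots> = (r + b * u) * r' + r * (c * u') + (b * c) * (u * u')"
      by (simp add: algebra_simps)
    finally have "a\<^sup>2 = a * r' + r * (c * u') + (b * c) * (u * u')" by (simp only: flip: *(5))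
    moreover have "a * r' \<in> M" using a(1) *(3) by (rule idealAD(4)[OF id])
    moreover have "r * (c * u') \<in> M" using *(1) A_mult[OF bc(2) *(4)] by (rule idealAD(5)[OF id])
    moreover have "(b * c) * (u * u') \<in> M" using bc(3) A_mult[OF *(2,4)] by (rule idealAD(5)[OF id])
    ultimately have "a\<^sup>2 \<in> M" using idealAD(3)[OF id] by simp
    then have "a\<^sup>2 * a ^ (N - 2) \<in> M" using idealAD(5)[OF id] A_power[OF a(1)] by blast
    then have "a ^ N \<in> M" using N(1) by (simp only: power_add[symmetric] le_add_diff_inverse)
    moreover have "a ^ N - a \<in> M" using N(2) wM idealAD(5)[OF id] unfolding dvdA_def by auto
    ultimately have "a ^ N - (a ^ N - a) \<in> M" by (rule idealAD(6)[OF id])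
    then show False using aM by simp
  qed
  then show thesis using that id wM aM by blast
qed

text \<open>The localization of \<open>A\<close> at a prime ideal containing \<open>w e\<close> and
  avoiding \<open>a\<close> is a discrete valuation ring with uniformizer \<open>w e\<close>, and
  \<open>v\<close> is its valuation.\<close>

lemma place_avoiding:
  assumes e: "e \<ge> 1" and a: "a \<in> A" "\<not> dvdA (w e) a"
  obtains v where "v \<in> places k" "\<And>b. b \<in> A \<Longrightarrow> b \<noteq> 0 \<Longrightarrow> v b \<ge> 0" "v a = 0" "v (w e) = 1"
proof -
  let ?w = "w e"
  obtain N where N: "N \<ge> 2" "\<And>b. b \<in> A \<Longrightarrow> dvdA ?w (b ^ N - b)" using A_power_cong[OF e] by blast
  obtain M where M: "idealA M" "?w \<in> M" "a \<notin> M"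
    and prime: "\<And>b c. b \<in> A \<Longrightarrow> c \<in> A \<Longrightarrow> b * c \<in> M \<Longrightarrow> b \<in> M \<or> c \<in> M"
    using prime_ideal_avoiding[OF w_in_A a N(1) N(2)[OF a(1)]] by blast
  note id = idealAD[OF M(1)]
  let ?R = "A - M"
  have oneR: "1 \<in> ?R" using id(5)[of 1 a] a(1) M(3) A_01(2) by auto
  have multR: "b * c \<in> ?R" if "b \<in> ?R" "c \<in> ?R" for b c using that prime A_mult by blast
  have powR: "b ^ i \<in> ?R" if "b \<in> ?R" for b i using that oneR multR by (induction i) auto
  have w0: "?w \<noteq> 0" using w_nonzero[OF e] .
  have w_multiple: "?w ^ Suc i * b \<in> M" if "b \<in> A" for i b
    using id(5)[OF M(2), of "?w ^ i * b"] A_mult[OF A_power[OF w_in_A] that] by (simp add: mult.assoc)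
  \<comment> \<open>\<open>D b j\<close> says that \<open>b\<close> is \<open>?w ^ j\<close> times a
    unit of the localization at \<open>M\<close>.\<close>
  define D where "D b j \<longleftrightarrow> (\<exists>u\<in>?R. \<exists>c\<in>?R. u * b = ?w ^ j * c)" for b j
  have DI: "D b j" if "u \<in> ?R" "c \<in> ?R" "u * b = ?w ^ j * c" for b j u c
    using that unfolding D_def by blast
  have D_ex: "\<exists>j. D b j" if b: "b \<in> A" "b \<noteq> 0" for b
  proof -
    obtain e' E where e': "e' \<ge> 1" "dvdA b (w (e * e') ^ E)" using dvdA_w_power[OF b e] .
    then obtain b' where b': "b' \<in> A" "w (e * e') ^ E = b * b'" unfolding dvdA_def by blast
    obtain s where s: "s \<in> A" "w (e * e') = ?w * (1 + ?w * s)" using w_mult[OF e e'(1)] by blast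
    \<comment> \<open>\<open>?h\<close> is 1 modulo \<open>M\<close>, so up to a unit of the
      localization \<open>b\<close> divides \<open>?w ^ E\<close>.\<close>
    let ?h = "1 + ?w * s"
    have "?h \<in> A" by (intro A_add A_mult A_01 w_in_A s(1))
    moreover have "?h \<notin> M" using id(6)[of ?h "?w * s"] id(5)[OF M(2) s(1)] oneR by auto
    ultimately have hR: "?h \<in> ?R" by simp
    \<comment> \<open>Here the cofactor \<open>c\<close> is only required to lie in
      \<open>A\<close>, so 0 belongs to the set; the exponents are bounded by \<open>E\<close>, and
      the largest one is the order.\<close>
    let ?S = "{j. \<exists>u\<in>?R. \<exists>c\<in>A. u * b = ?w ^ j * c}"
    have "j \<le> E" if jS: "j \<in> ?S" for j
    proof (rule ccontr)
      assume "\<not> j \<le> E"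
      then obtain l where l: "j = E + Suc l" using less_imp_Suc_add[of E j] by auto
      obtain u c where u: "u \<in> ?R" "c \<in> A" "u * b = ?w ^ j * c" using jS by blast
      have "?w ^ E * (u * ?h ^ E) = u * (b * b')"
        unfolding b'(2)[symmetric] s(2) by (simp only: power_mult_distrib mult_ac)
      also have "\<dots> = ?w ^ E * (?w ^ Suc l * (c * b'))"
        using u(3) unfolding l by (simp add: power_add mult.assoc[symmetric])
      finally have "u * ?h ^ E = ?w ^ Suc l * (c * b')" using w0 by simp
      moreover have "u * ?h ^ E \<in> ?R" by (intro multR powR u hR)
      ultimately show False using w_multiple[OF A_mult[OF u(2) b'(1)]] by auto
    qed
    then have fin: "finite ?S" using finite_nat_set_iff_bounded_le by blast
    have "0 \<in> ?S" using oneR b(1) by (intro CollectI bexI[of _ 1] bexI[of _ b]) auto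
    then have "Max ?S \<in> ?S" using Max_in[OF fin] by blast
    then obtain u c where u: "u \<in> ?R" "c \<in> A" "u * b = ?w ^ Max ?S * c" by blast
    \<comment> \<open>If \<open>c\<close> lay in \<open>M\<close>, then
      \<open>c * (c ^ (N - 1) - 1)\<close> would be a multiple of \<open>?w\<close> with second
      factor outside \<open>M\<close>, which would allow one more power of
      \<open>?w\<close>.\<close>
    have "c \<notin> M"
    proof
      assume cM: "c \<in> M"
      obtain d where d: "d \<in> A" "c ^ N - c = ?w * d" using N(2)[OF u(2)] unfolding dvdA_def by blast
      let ?u = "c ^ (N - 1) - 1"
      have "N - 1 = Suc (N - 2)" "N = Suc (N - 1)" using N(1) by auto
      then have "c ^ (N - 1) = c * c ^ (N - 2)" "c ^ N = c * c ^ (N - 1)" by (metis power_Suc)+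
      note pow = this
      then have "c ^ (N - 1) \<in> M" using id(5)[OF cM A_power[OF u(2)]] by simp
      then have "?u \<notin> M" using id(6)[of "c ^ (N - 1)" ?u] oneR by auto
      moreover have "?u \<in> A" by (intro A_diff A_power A_01 u(2))
      ultimately have "?u \<in> ?R" by simp
      have "c * ?u = ?w * d"
        unfolding d(2)[symmetric] pow(2) by (simp only: right_diff_distrib mult_1_right)
      have "(u * ?u) * b = ?u * (u * b)" by (simp only: mult_ac)
      also have "\<dots> = ?u * (?w ^ Max ?S * c)" by (simp only: u(3))
      also have "\<dots> = ?w ^ Max ?S * (c * ?u)" by (simp only: mult_ac)
      also have "\<dots> = ?w ^ Suc (Max ?S) * d" unfolding \<open>c * ?u = ?w * d\<close> by (simp only: power_Suc mult_ac)
      finally have "(u * ?u) * b = ?w ^ Suc (Max ?S) * d" .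
      moreover have "u * ?u \<in> ?R" by (intro multR u(1) \<open>?u \<in> ?R\<close>)
      ultimately have "Suc (Max ?S) \<in> ?S" using d(1) by blast
      then show False using Max_ge[OF fin] by fastforce
    qed
    then show ?thesis unfolding D_def using u by blast
  qed
  \<comment> \<open>The exponent is unique: cancelling the smaller power would put a product of
    elements outside \<open>M\<close> into \<open>M\<close>.\<close>
  have D_le: "i \<le> j" if "D b i" "D b j" for b i j
  proof (rule ccontr)
    assume "\<not> i \<le> j"
    then obtain l where l: "i = j + Suc l" using less_imp_Suc_add[of j i] by auto
    obtain u c where u: "u \<in> ?R" "c \<in> ?R" "u * b = ?w ^ i * c" using \<open>D b i\<close> unfolding D_def by blast
    obtain u' c' where u': "u' \<in> ?R" "c' \<in> ?R" "u' * b = ?w ^ j * c'"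
      using \<open>D b j\<close> unfolding D_def by blast
    have "?w ^ j * (u * c') = u * (u' * b)" unfolding u'(3) by (simp only: mult_ac)
    also have "\<dots> = u' * (u * b)" by (simp only: mult_ac)
    also have "\<dots> = ?w ^ j * (?w ^ Suc l * (u' * c))" unfolding u(3) l power_add by (simp only: mult_ac)
    finally have "u * c' = ?w ^ Suc l * (u' * c)" using w0 by simp
    then have "u * c' \<in> M" using w_multiple[of "u' * c"] A_mult u(2) u'(1) by auto
    then show False using multR[OF u(1) u'(2)] by auto
  qed
  define d where "d b = (SOME j. D b j)" for b
  have d_eq: "d b = j" if "D b j" for b j
    using someI[of "D b", OF that] D_le that unfolding d_def by (metis le_antisym)
  have D_d: "D b (d b)" if "b \<in> A" "b \<noteq> 0" for b
    using someI_ex[OF D_ex[OF that]] unfolding d_def .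
  have D_R: "D b 0" if "b \<in> ?R" for b
    unfolding D_def using that oneR by (intro bexI[of _ 1] bexI[of _ b]) auto
  have D_w: "D ?w 1"
    unfolding D_def using oneR by (intro bexI[of _ 1] bexI[of _ 1]) auto
  obtain v where v: "v \<in> places k" "\<And>b. b \<in> A \<Longrightarrow> b \<noteq> 0 \<Longrightarrow> v b = int (d b)"
  proof (rule place_extension[of A k "\<lambda>b. int (d b)"])
    fix b c assume bc: "b \<in> A" "c \<in> A" "b \<noteq> 0" "c \<noteq> 0"
    obtain u b' where u: "u \<in> ?R" "b' \<in> ?R" "u * b = ?w ^ d b * b'" using D_d[OF bc(1,3)] unfolding D_def by blast
    obtain u' c' where u': "u' \<in> ?R" "c' \<in> ?R" "u' * c = ?w ^ d c * c'" using D_d[OF bc(2,4)] unfolding D_def by blast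
    have "(u * u') * (b * c) = (u * b) * (u' * c)" by (simp only: mult_ac)
    also have "\<dots> = ?w ^ (d b + d c) * (b' * c')" unfolding u(3) u'(3) power_add by (simp only: mult_ac)
    finally have "D (b * c) (d b + d c)" unfolding D_def using multR u u' by blast
    then show "int (d (b * c)) = int (d b) + int (d c)" using d_eq by simp
    assume nz: "b + c \<noteq> 0"
    \<comment> \<open>After the common power \<open>?w ^ ?j\<close> is taken out, the nonzero
      cofactor \<open>?r\<close> lies in \<open>A\<close> and has an order of its own, which only
      adds to \<open>?j\<close>.\<close>
    let ?j = "min (d b) (d c)"
    let ?r = "u' * (?w ^ (d b - ?j) * b') + u * (?w ^ (d c - ?j) * c')"
    have pow: "?w ^ d b = ?w ^ ?j * ?w ^ (d b - ?j)" "?w ^ d c = ?w ^ ?j * ?w ^ (d c - ?j)"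
      by (simp_all only: power_add[symmetric] le_add_diff_inverse min.cobounded1 min.cobounded2)
    have "(u * u') * (b + c) = u' * (u * b) + u * (u' * c)" by (simp only: distrib_left mult_ac)
    also have "\<dots> = ?w ^ ?j * (u' * (?w ^ (d b - ?j) * b')) + ?w ^ ?j * (u * (?w ^ (d c - ?j) * c'))"
      unfolding u(3) u'(3) by (subst pow(1), subst pow(2)) (simp only: mult_ac)
    finally have eq: "(u * u') * (b + c) = ?w ^ ?j * ?r" by (simp only: distrib_left)
    have "u \<noteq> 0" "u' \<noteq> 0" using u(1) u'(1) id(2) by auto
    then have "?r \<noteq> 0" using eq nz by auto
    moreover have "?r \<in> A" using u u' by (intro A_add A_mult A_power w_in_A) auto
    ultimately obtain u'' r' where r: "u'' \<in> ?R" "r' \<in> ?R" "u'' * ?r = ?w ^ d ?r * r'"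
      using D_d[of ?r] unfolding D_def by blast
    have "(u'' * (u * u')) * (b + c) = u'' * ((u * u') * (b + c))" by (rule mult.assoc)
    also have "\<dots> = u'' * (?w ^ ?j * ?r)" by (simp only: eq)
    also have "\<dots> = ?w ^ ?j * (u'' * ?r)" by (rule mult.left_commute)
    also have "\<dots> = ?w ^ (?j + d ?r) * r'" unfolding r(3) power_add by (rule mult.assoc[symmetric])
    finally have eq': "(u'' * (u * u')) * (b + c) = ?w ^ (?j + d ?r) * r'" .
    have "u'' * (u * u') \<in> ?R" by (intro multR r(1) u(1) u'(1))
    then have "D (b + c) (?j + d ?r)" using r(2) eq' by (rule DI)
    then have "?j \<le> d (b + c)" using d_eq by (metis le_add1)
    then show "min (int (d b)) (int (d c)) \<le> int (d (b + c))" by simp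
  next
    fix c assume c: "c \<in> k" "c \<noteq> 0"
    then have "c \<notin> M" using id(5)[of c "inverse c"] A_const[OF k_closed(6)[OF c(1)]] oneR by auto
    then show "int (d c) = 0" using d_eq[OF D_R] A_const[OF c(1)] by simp
  next
    show "\<exists>a\<in>A. \<exists>b\<in>A. a \<noteq> 0 \<and> b \<noteq> 0 \<and> int (d a) = int (d b) + 1"
      using d_eq[OF D_w] d_eq[OF D_R[OF oneR]] w0 w_in_A[of e] A_01(2)
      by (intro bexI[of _ 1] bexI[of _ ?w]) auto
  qed (use A_add A_mult A_const k_closed(2) fraction that in auto)
  have "a \<noteq> 0" using M(3) id(2) by auto
  then have "v a = 0" using v(2)[OF a(1)] d_eq[OF D_R[of a]] a(1) M(3) by simp
  moreover have "v ?w = 1" using v(2)[OF w_in_A w0] d_eq[OF D_w] by simp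
  ultimately show thesis using that v by simp
qed

text \<open>Clear the denominator with the least power \<open>E0\<close> of some \<open>w e\<close>.
  By minimality \<open>f * w e ^ E0\<close> is not divisible by \<open>w e\<close>, so at a place
  where it has value 0 and \<open>w e\<close> has value 1, \<open>f\<close> has a pole of order
  \<open>E0\<close>.\<close>

lemma A_integrally_closed:
  assumes "f \<notin> A"
  obtains v where "v \<in> places k" "\<And>b. b \<in> A \<Longrightarrow> b \<noteq> 0 \<Longrightarrow> v b \<ge> 0" "v f < 0"
proof -
  obtain b c where bc: "b \<in> A" "c \<in> A" "c \<noteq> 0" "f = b / c" using fraction by blast
  obtain e E where e: "e \<ge> 1" "dvdA c (w (1 * e) ^ E)" using dvdA_w_power[OF bc(2,3), of 1] by auto
  let ?w = "w e"
  have w0: "?w \<noteq> 0" using w_nonzero[OF e(1)] .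
  obtain c' where c': "c' \<in> A" "?w ^ E = c * c'" using e(2) unfolding dvdA_def by auto
  have "f * ?w ^ E = b * c'" using bc(3,4) c'(2) by simp
  then have ex: "f * ?w ^ E \<in> A" using A_mult bc(1) c'(1) by simp
  define E0 where "E0 = (LEAST E. f * ?w ^ E \<in> A)"
  have E0: "f * ?w ^ E0 \<in> A" unfolding E0_def by (rule LeastI[of _ E]) (rule ex)
  then obtain E1 where E1: "E0 = Suc E1" using assms by (cases E0) auto
  have "\<not> dvdA ?w (f * ?w ^ E0)"
  proof
    assume "dvdA ?w (f * ?w ^ E0)"
    then have "f * ?w ^ E1 \<in> A" unfolding dvdA_def E1 using w0 by (auto simp: mult.left_commute[of f])
    then show False using not_less_Least[of E1 "\<lambda>E. f * ?w ^ E \<in> A"] E1 unfolding E0_def by simp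
  qed
  then obtain v where v: "v \<in> places k" "\<And>b. b \<in> A \<Longrightarrow> b \<noteq> 0 \<Longrightarrow> v b \<ge> 0" "v (f * ?w ^ E0) = 0" "v ?w = 1"
    using place_avoiding[OF e(1) E0] by blast
  have "f \<noteq> 0" using assms A_01(1) by auto
  then have "v f + int E0 = 0"
    using v(3,4) places_mult[OF v(1), of f "?w ^ E0"] places_power[OF v(1)] w0 by simp
  then show thesis using that v(1,2) E1 by simp
qed

section \<open>The Weierstrass semigroup\<close>

lemma origin_P: "P z = 1" "P y = int m" "P x = int (m * (q + 1))"
  using origin_uniformizer[OF P_place P_origin] origin_values[OF P_place P_origin] by auto

text \<open>The sign of \<open>v x\<close> decides which terms dominate in the curve equations. A
  zero of \<open>x\<close> forces zeros of \<open>y\<close> and \<open>z\<close>; a pole fixes the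
  ratios of the three values.\<close>

lemma places_curve:
  assumes v: "v \<in> places k"
  shows "v x > 0 \<Longrightarrow> v = P"
    and "v x = 0 \<Longrightarrow> v y \<ge> 0 \<and> v z \<ge> 0"
    and "v x < 0 \<Longrightarrow> int (q + 1) * v y = int q * v x \<and> int m * v z = int (q\<^sup>2) * v y"
proof -
  have q2: "1 < (int q)\<^sup>2" using q_ge by (intro one_less_power) auto
  have vy: "int (q + 1) * v y = v (x + x ^ q)"
    using x_eq places_power[OF v, of y "q + 1"] by (simp only: add.commute)
  have vz: "int m * v z = v (- y + y ^ q\<^sup>2)"
    using y_eq places_power[OF v, of z m] by (simp only: uminus_add_conv_diff)
  have xnz: "x + x ^ q \<noteq> 0" using x_eq nonzero by (simp add: add.commute)
  have ynz: "- y + y ^ q\<^sup>2 \<noteq> 0" using y_eq nonzero by (simp only: uminus_add_conv_diff) simp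
  show "v = P" if "v x > 0"
  proof -
    have "v x < v (x ^ q)"
      using that q_ge mult_strict_right_mono[of 1 "int q" "v x"] places_power[OF v] by simp
    then have "int (q + 1) * v y = v x" using vy places_add_dominant[OF v, of x] nonzero by simp
    then have "0 < int (q + 1) * v y" using that by simp
    then have y: "v y > 0" by (simp add: zero_less_mult_iff)
    have "v (- y) < v (y ^ q\<^sup>2)"
      using y q2 mult_strict_right_mono[of 1 "int (q\<^sup>2)" "v y"] places_power[OF v] places_uminus[OF v]
      by simp
    then have "int m * v z = v y"
      using vz places_add_dominant[OF v, of "- y"] nonzero places_uminus[OF v] by simp
    then have "0 < int m * v z" using y by simp
    then have "v z > 0" by (simp add: zero_less_mult_iff)
    then show ?thesis using origin_unique[OF v] that y unfolding lies_over_origin_def by simp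
  qed
  show "v y \<ge> 0 \<and> v z \<ge> 0" if "v x = 0"
  proof -
    have "v (x + x ^ q) \<ge> 0"
      using places_add[OF v _ _ xnz] nonzero that places_power[OF v] by simp
    then have "0 \<le> int (q + 1) * v y" by (simp only: vy)
    then have y: "v y \<ge> 0" by (simp add: zero_le_mult_iff)
    then have "0 \<le> min (v (- y)) (v (y ^ q\<^sup>2))"
      using places_power[OF v] places_uminus[OF v] by simp
    also have "\<dots> \<le> v (- y + y ^ q\<^sup>2)" using places_add[OF v _ _ ynz] nonzero by simp
    finally have "0 \<le> v (- y + y ^ q\<^sup>2)" .
    then have "0 \<le> int m * v z" by (simp only: vz)
    then show ?thesis using y m_gt by (simp add: zero_le_mult_iff)
  qed
  show "int (q + 1) * v y = int q * v x \<and> int m * v z = int (q\<^sup>2) * v y" if "v x < 0"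
  proof -
    have "v (x ^ q) < v x"
      using that q_ge mult_strict_right_mono_neg[of 1 "int q" "v x"] places_power[OF v] by simp
    then have y: "int (q + 1) * v y = int q * v x"
      using vy places_add_dominant[OF v, of "x ^ q" x] nonzero places_power[OF v] by (simp add: add.commute)
    have "int q * v x < 0" using that q_ge by (simp add: mult_less_0_iff)
    then have "int (q + 1) * v y < 0" using y by simp
    then have "v y < 0" by (simp add: mult_less_0_iff)
    then have "v (y ^ q\<^sup>2) < v (- y)"
      using q2 mult_strict_right_mono_neg[of 1 "int (q\<^sup>2)" "v y"] places_power[OF v] places_uminus[OF v]
      by simp
    then have "int m * v z = int (q\<^sup>2) * v y"
      using vz places_add_dominant[OF v, of "y ^ q\<^sup>2" "- y"] nonzero places_power[OF v]
      by (simp add: add.commute)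
    with y show ?thesis by simp
  qed
qed

text \<open>The function is \<open>y ^ b * z ^ c / x ^ s\<close>: on the affine curve its
  denominator vanishes only at \<open>P\<close>, and the inequality excludes a pole at
  infinity.\<close>

lemma monomial_pole_number:
  assumes le: "m * q * b + q ^ 3 * c \<le> m * (q + 1) * s"
  shows "int (m * (q + 1) * s) - int (m * b + c) \<in> weierstrass_semigroup k P"
proof -
  define f where "f = y ^ b * z ^ c / x ^ s"
  have f: "f \<noteq> 0" unfolding f_def using nonzero by simp
  have vf: "v f = int b * v y + int c * v z - int s * v x" if "v \<in> places k" for v
    unfolding f_def using nonzero
    by (simp add: places_divide[OF that] places_mult[OF that] places_power[OF that])
  \<comment> \<open>The order of \<open>y ^ b * z ^ c\<close> at the origin is at most its pole
    order at infinity, so the claimed pole number is nonnegative.\<close>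
  have "b \<le> q * b" "c \<le> q ^ 3 * c" using q_ge by auto
  then have "m * b + c \<le> m * (q * b) + q ^ 3 * c" by (intro add_mono mult_left_mono) auto
  then have nonneg: "m * b + c \<le> m * (q + 1) * s" using le by (simp add: mult.assoc)
  have "v f \<ge> 0" if v: "v \<in> places k" "v \<noteq> P" for v
  proof -
    consider "v x > 0" | "v x = 0" | "v x < 0" by linarith
    then show ?thesis
    proof cases
      case 1
      then show ?thesis using places_curve(1)[OF v(1)] v(2) by simp
    next
      case 2
      then show ?thesis using places_curve(2)[OF v(1)] vf[OF v(1)] by simp
    next
      case 3
      define M Q B C S where "M = int m" "Q = int q" "B = int b" "C = int c" "S = int s"
      note defs = M_Q_B_C_S_def
      have y: "(Q + 1) * v y = Q * v x" and z: "M * v z = Q\<^sup>2 * v y"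
        using places_curve(3)[OF v(1) 3] by (simp_all add: defs add.commute)
      have z': "(Q + 1) * (M * v z) = Q ^ 3 * v x"
        unfolding z using y by (metis mult.left_commute mult.assoc power2_eq_square power3_eq_cube)
      \<comment> \<open>Multiplying by \<open>M * (Q + 1)\<close> clears the ratios, and every term
        becomes a multiple of \<open>v x\<close>.\<close>
      have "M * (Q + 1) * (B * v y + C * v z - S * v x)
        = M * B * ((Q + 1) * v y) + C * ((Q + 1) * (M * v z)) - M * (Q + 1) * S * v x"
        by (simp add: algebra_simps)
      also have "\<dots> = (M * Q * B + Q ^ 3 * C - M * (Q + 1) * S) * v x"
        unfolding y z' by (simp add: algebra_simps)
      also have "\<dots> \<ge> 0"
      proof (rule mult_nonpos_nonpos)
        have "int (m * q * b + q ^ 3 * c) \<le> int (m * (q + 1) * s)" using le by (simp only: of_nat_le_iff)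
        then show "M * Q * B + Q ^ 3 * C - M * (Q + 1) * S \<le> 0" by (simp add: defs algebra_simps)
      qed (use 3 in simp)
      finally have "0 \<le> M * (Q + 1) * (B * v y + C * v z - S * v x)" .
      moreover have "M * (Q + 1) > 0" using m_gt by (simp add: defs)
      ultimately have "0 \<le> B * v y + C * v z - S * v x" by (simp add: zero_le_mult_iff)
      then show ?thesis using vf[OF v(1)] by (simp add: defs)
    qed
  qed
  moreover have "- P f = int (m * (q + 1) * s) - int (m * b + c)"
    using vf[OF P_place] origin_P by (simp add: algebra_simps)
  moreover have "int (m * b + c) \<le> int (m * (q + 1) * s)" using nonneg by (simp only: of_nat_le_iff)
  ultimately have "pole_divisor k f = (\<lambda>Q. if Q = P then int (m * (q + 1) * s) - int (m * b + c) else 0)"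
    unfolding pole_divisor_def using P_place by (intro ext) auto
  then show ?thesis
    unfolding weierstrass_semigroup_def using f \<open>int (m * b + c) \<le> _\<close>
    by (intro CollectI conjI exI[of _ f]) (simp_all only: diff_ge_0_iff_ge not_False_eq_True)
qed

lemma pole_number_monomial:
  assumes r: "r \<in> weierstrass_semigroup k P"
  obtains s b c where "b \<le> q" "c < m" "m * q * b + q ^ 3 * c \<le> m * (q + 1) * s"
    "r = int (m * (q + 1) * s) - int (m * b + c)"
proof (cases "r = 0")
  \<comment> \<open>For \<open>r = 0\<close> the pole divisor gives only \<open>P f \<ge> 0\<close>
    instead of an exact order, so this case is separate.\<close>
  case True
  then show thesis using that[of 0 0 0] m_gt by simp
next
  case False
  obtain f where f: "f \<noteq> 0" "pole_divisor k f = (\<lambda>Q. if Q = P then r else 0)" and r0: "r \<ge> 0"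
    using r unfolding weierstrass_semigroup_def by auto
  have Pf: "P f = - r" using fun_cong[OF f(2), of P] P_place False r0
    unfolding pole_divisor_def by (auto simp: max_def split: if_splits)
  have vf: "v f \<ge> 0" if "v \<in> places k" "v \<noteq> P" for v
    using fun_cong[OF f(2), of v] that unfolding pole_divisor_def by (auto simp: max_def split: if_splits)
  \<comment> \<open>\<open>x\<close> vanishes at the origin, so \<open>r\<close> factors of it
    cancel a pole of order \<open>r\<close>.\<close>
  define s where "s = nat r"
  define g where "g = x ^ s * f"
  have g: "g \<noteq> 0" unfolding g_def using f(1) nonzero by simp
  have vg: "v g = int s * v x + v f" if "v \<in> places k" for v
    unfolding g_def using f(1) nonzero by (simp add: places_mult[OF that] places_power[OF that])
  have Px: "P x \<ge> 1" using origin_P(3) m_gt by (simp add: of_nat_mult[symmetric] Suc_leI del: of_nat_mult)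
  have "g \<in> A"
  proof (rule ccontr)
    assume "g \<notin> A"
    then obtain v where v: "v \<in> places k" "\<And>b. b \<in> A \<Longrightarrow> b \<noteq> 0 \<Longrightarrow> v b \<ge> 0" "v g < 0"
      using A_integrally_closed by blast
    have "v g \<ge> 0"
    proof (cases "v = P")
      case True
      have "int s * 1 \<le> int s * P x" using Px by (intro mult_left_mono) auto
      then show ?thesis using vg[OF P_place] Pf r0 True by (simp add: s_def)
    next
      case False
      then show ?thesis using vg[OF v(1)] vf[OF v(1)] v(2)[OF A_gen(1) nonzero(1)] by simp
    qed
    with v(3) show False by simp
  qed
  obtain v where v: "v \<in> places k" "\<And>a. a \<in> A \<Longrightarrow> a \<noteq> 0 \<Longrightarrow> v a = - int (deg a)"
    using place_at_infinity by blast
  have vx: "v x = - int (m * (q + 1))"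
    using v(2)[OF A_gen(1) nonzero(1)] deg_monomial[of 1 0 0] by simp
  then have "v x = - P x" using origin_P(3) by simp
  then have "v \<noteq> P" using Px by auto
  then have "int (deg g) \<le> int (m * (q + 1) * s)"
    using vg[OF v(1)] vf[OF v(1)] v(2)[OF \<open>g \<in> A\<close> g] vx by (simp add: algebra_simps)
  then have deg: "deg g \<le> m * (q + 1) * s" by (simp only: of_nat_le_iff)
  \<comment> \<open>The lowest term of \<open>g\<close> at the origin is a monomial of weight at
    most \<open>deg g\<close>; here the conditions at the two points meet.\<close>
  obtain i where i: "W i < Suc (deg g)" "P g = int i"
    using origin_order[OF mem_U_Suc_deg[OF \<open>g \<in> A\<close>] g] P_place P_origin origin_P(1) by (metis mult_1_right)
  obtain a b c where abc: "b \<le> q" "c < m" "i = m * ((q + 1) * a + b) + c" by (rule index_cases)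
  have W: "m * (q + 1) * a + m * q * b + q ^ 3 * c \<le> m * (q + 1) * s"
    using i(1) deg W_index[OF abc(1,2), of a] abc(3) by simp
  then have "m * (q + 1) * a \<le> m * (q + 1) * s" by linarith
  then have "a \<le> s" using m_gt by simp
  then obtain s' where s': "s = a + s'" using le_Suc_ex by blast
  have "r = int s * P x - int i" using vg[OF P_place] Pf i(2) by simp
  then have "r = int (m * (q + 1) * s') - int (m * b + c)"
    unfolding origin_P abc(3) s' by (simp add: algebra_simps)
  moreover have "m * q * b + q ^ 3 * c \<le> m * (q + 1) * s'" using W unfolding s' by (simp add: algebra_simps)
  ultimately show thesis using that abc(1,2) by blast
qed

end

section \<open>The list of pole numbers\<close>

text \<open>The difference of \<open>m * (q + 1) * s - m * q * r\<close> and
  \<open>q ^ 3 * GGS_T q m s r\<close> is \<open>r * (q\<^sup>2 - q) + s\<close>, which is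
  nonnegative and below \<open>q ^ 3\<close>. So \<open>GGS_T\<close> is the quotient by
  \<open>q ^ 3\<close> rounded down.\<close>

lemma le_GGS_T_iff:
  fixes q m s r t :: int
  assumes q: "q \<ge> 2" and n: "n \<ge> 3" "m * (q + 1) = q ^ n + 1"
    and s: "0 \<le> s" "s < q\<^sup>2" and r: "0 \<le> r" "r \<le> q"
  shows "t \<le> GGS_T q m s r \<longleftrightarrow> m * q * r + q ^ 3 * t \<le> m * (q + 1) * s"
proof -
  let ?T = "GGS_T q m s r"
  define u where "u = (m - q\<^sup>2 + q - 1) div q ^ 3"
  have u: "q ^ 3 * u = m - q\<^sup>2 + q - 1" unfolding u_def using GGS_T_exact[OF n] by simp
  have "q ^ 3 * ?T = ((s - r) * q + s) * (q ^ 3 * u) + q ^ 3 * (s - r)"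
    unfolding GGS_T_def u_def[symmetric] by (simp add: algebra_simps)
  also have "\<dots> = m * (q + 1) * s - m * q * r - (r * (q\<^sup>2 - q) + s)"
    unfolding u by (simp add: algebra_simps power2_eq_square power3_eq_cube)
  finally have T: "q ^ 3 * ?T = m * (q + 1) * s - m * q * r - (r * (q\<^sup>2 - q) + s)" .
  have "q\<^sup>2 - q = q * (q - 1)" by (simp add: algebra_simps power2_eq_square)
  then have pos: "q\<^sup>2 - q \<ge> 0" using q by simp
  have "r * (q\<^sup>2 - q) \<le> q * (q\<^sup>2 - q)" using r(2) pos by (rule mult_right_mono)
  also have "\<dots> = q ^ 3 - q\<^sup>2" by (simp add: algebra_simps power2_eq_square power3_eq_cube)
  finally have hi: "r * (q\<^sup>2 - q) + s < q ^ 3" using s by simp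
  have lo: "0 \<le> r * (q\<^sup>2 - q) + s" using s r pos by simp
  have q3: "q ^ 3 > 0" using q by simp
  show ?thesis
  proof
    assume "t \<le> ?T"
    then have "q ^ 3 * t \<le> q ^ 3 * ?T" using q3 by simp
    then show "m * q * r + q ^ 3 * t \<le> m * (q + 1) * s" using T lo by linarith
  next
    assume "m * q * r + q ^ 3 * t \<le> m * (q + 1) * s"
    then have "q ^ 3 * t < q ^ 3 * ?T + q ^ 3" using T hi by linarith
    then have "q ^ 3 * t < q ^ 3 * (?T + 1)" by (simp add: algebra_simps)
    then have "t < ?T + 1" using q3 by simp
    then show "t \<le> ?T" by simp
  qed
qed

text \<open>By \<open>q + 1 \<le> q\<^sup>2\<close> and \<open>n \<ge> 5\<close>. Lowering
  \<open>s\<close> or raising \<open>r\<close> by one therefore costs more than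
  \<open>q ^ 3\<close>, the distance from \<open>2 * g - 1\<close> up to
  \<open>m * (q + 1) * (q\<^sup>2 - 1)\<close>.\<close>

lemma q_cube_less_m:
  fixes q m :: int
  assumes q: "q \<ge> 2" and n: "n \<ge> 5" "m * (q + 1) = q ^ n + 1"
  shows "q ^ 3 < m"
proof -
  have "q + 1 \<le> 2 * q" using q by simp
  also have "\<dots> \<le> q\<^sup>2" using q by (simp add: power2_eq_square)
  finally have "q ^ 3 * (q + 1) \<le> q ^ 3 * q\<^sup>2" using q by (intro mult_left_mono) auto
  also have "\<dots> = q ^ 5" by (simp flip: power_add)
  also have "\<dots> \<le> q ^ n" using q n(1) by (intro power_increasing) auto
  finally have "q ^ 3 * (q + 1) < m * (q + 1)" using n(2) by simp
  then show ?thesis using q by simp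
qed

text \<open>The bound on \<open>N\<close> is \<open>2 * g - 1\<close>. Where \<open>t\<close> runs
  up to \<open>GGS_T\<close>, the inequality is the defining property of \<open>GGS_T\<close>; where
  \<open>t\<close> runs up to \<open>m - 1\<close>, it holds even with \<open>m\<close> in place of
  \<open>t\<close>.\<close>

lemma GGS_lists_sound:
  fixes q m N :: int
  assumes q: "q \<ge> 2" and n: "n \<ge> 5" "m * (q + 1) = q ^ n + 1"
    and N: "N \<in> GGS_L1 q m \<union> GGS_L2 q m \<union> GGS_L3 q m \<union> GGS_L4 q m \<union> GGS_L5 q m \<union> GGS_L6 q m \<union> GGS_L7 q m"
  obtains s r t where "0 \<le> s" "0 \<le> r" "0 \<le> t" "m * q * r + q ^ 3 * t \<le> m * (q + 1) * s"
    "N = m * (q + 1) * s - m * r - t" "N \<le> m * (q + 1) * (q\<^sup>2 - 1) - q ^ 3"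
proof -
  have q3: "q ^ 3 < m" using q_cube_less_m[OF q n] .
  have "0 < q ^ 3" using q by simp
  then have m0: "0 < m" using q3 by linarith
  have qq: "2 * q \<le> q\<^sup>2" using q by (simp add: power2_eq_square)
  have T: "m * q * r + q ^ 3 * t \<le> m * (q + 1) * s"
    if "t \<le> GGS_T q m s r" "0 \<le> s" "s < q\<^sup>2" "0 \<le> r" "r \<le> q" for s r t
    using le_GGS_T_iff[OF q _ n(2)] n(1) that by simp
  have small: "m * (q + 1) * s - m * r - t \<le> m * (q + 1) * (q\<^sup>2 - 1) - q ^ 3"
    if "s \<le> q\<^sup>2 - 2" "0 \<le> r" "0 \<le> t" for s r t
  proof -
    have "m * (q + 1) * s \<le> m * (q + 1) * (q\<^sup>2 - 2)" using m0 q that by (intro mult_left_mono) auto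
    moreover have "0 \<le> m * r" "0 \<le> m * q" using m0 that q by auto
    ultimately show ?thesis using q3 that by (simp add: algebra_simps)
  qed
  have full: "m * (q + 1) * (q\<^sup>2 - 1) - m * r - t \<le> m * (q + 1) * (q\<^sup>2 - 1) - q ^ 3"
    if "1 \<le> r" "0 \<le> t" for r t
  proof -
    have "m * 1 \<le> m * r" using m0 that by (intro mult_left_mono) auto
    then show ?thesis using q3 that by simp
  qed
  have q3t: "q ^ 3 * t \<le> q ^ 3 * m" if "t \<le> m - 1" for t using that q by (intro mult_left_mono) auto
  consider (1) s r t where "N = - t - r * m + m * (q + 1) * s" "0 \<le> s" "s \<le> q\<^sup>2 - 2" "0 \<le> r" "r \<le> q"
      "0 \<le> t" "t \<le> GGS_T q m s r"
    | (3) s r t where "N = - t - r * m + m * (q + 1) * s" "q\<^sup>2 - q + 1 \<le> s" "s \<le> q\<^sup>2 - 2" "0 \<le> r"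
      "r \<le> q + s - q\<^sup>2 - 1" "0 \<le> t" "t \<le> m - 1"
    | (5) t where "N = - t + m * (q + 1) * (q\<^sup>2 - 1)" "q ^ 3 \<le> t" "t \<le> m - 1"
    | (6) r t where "N = - t - r * m + m * (q + 1) * (q\<^sup>2 - 1)" "1 \<le> r" "r \<le> q - 2" "0 \<le> t" "t \<le> m - 1"
    | (7) r t where "N = - t - r * m + m * (q + 1) * (q\<^sup>2 - 1)" "1 \<le> r" "r \<le> q"
      "0 \<le> t" "t \<le> GGS_T q m (q\<^sup>2 - 1) r"
  proof -
    consider "N \<in> GGS_L1 q m" | "N \<in> GGS_L2 q m" | "N \<in> GGS_L3 q m" | "N \<in> GGS_L4 q m"
      | "N \<in> GGS_L5 q m" | "N \<in> GGS_L6 q m" | "N \<in> GGS_L7 q m" using N by blast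
    then show thesis
    proof cases
      case 1
      then obtain s r t where *: "N = - t - r * m + m * (q + 1) * s" "0 \<le> s" "s \<le> q" "0 \<le> r" "r \<le> s"
        "0 \<le> t" "t \<le> GGS_T q m s r" unfolding GGS_L1_def by auto
      then show thesis using that(1)[of t r s] qq q by simp
    next
      case 2
      then obtain s r t where *: "N = - t - r * m + m * (q + 1) * s" "q + 1 \<le> s" "s \<le> q\<^sup>2 - q" "0 \<le> r" "r \<le> q"
        "0 \<le> t" "t \<le> GGS_T q m s r" unfolding GGS_L2_def by auto
      then show thesis using that(1)[of t r s] q by simp
    next
      case 3
      then show thesis using that(2) unfolding GGS_L3_def by auto
    next
      case 4
      then obtain s r t where *: "N = - t - r * m + m * (q + 1) * s" "q\<^sup>2 - q + 1 \<le> s" "s \<le> q\<^sup>2 - 2"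
        "q + s - q\<^sup>2 \<le> r" "r \<le> q" "0 \<le> t" "t \<le> GGS_T q m s r" unfolding GGS_L4_def by auto
      then show thesis using that(1)[of t r s] q qq by simp
    next
      case 5
      then show thesis using that(3) unfolding GGS_L5_def by auto
    next
      case 6
      then show thesis using that(4) unfolding GGS_L6_def by auto
    next
      case 7
      then obtain r t where *: "N = - t - r * m + m * (q + 1) * (q\<^sup>2 - 1)" "q - 1 \<le> r" "r \<le> q"
        "0 \<le> t" "t \<le> GGS_T q m (q\<^sup>2 - 1) r" unfolding GGS_L7_def by auto
      then show thesis using that(5)[of t r] q by simp
    qed
  qed
  then show thesis
  proof cases
    case (1 s r t)
    have "m * q * r + q ^ 3 * t \<le> m * (q + 1) * s" using T 1 by simp
    then show thesis using that[of s r t] 1 small[of s r t] by (simp add: algebra_simps)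
  next
    case (3 s r t)
    \<comment> \<open>The bound on \<open>r\<close> yields
      \<open>(q + 1) * s - q * r \<ge> q ^ 3\<close>, which leaves room for every
      \<open>t < m\<close>.\<close>
    have "q * r \<le> q * (q + s - q\<^sup>2 - 1)" using 3 q by (intro mult_left_mono) auto
    also have "\<dots> = (q + 1) * s - q ^ 3 - (s - q\<^sup>2 + q)"
      by (simp add: algebra_simps power2_eq_square power3_eq_cube)
    also have "\<dots> \<le> (q + 1) * s - q ^ 3" using 3 by simp
    finally have "m * (q * r) \<le> m * ((q + 1) * s - q ^ 3)" using m0 by (intro mult_left_mono) auto
    then have "m * q * r \<le> m * (q + 1) * s - q ^ 3 * m" by (simp add: algebra_simps)
    then have "m * q * r + q ^ 3 * t \<le> m * (q + 1) * s" using q3t[OF 3(7)] by linarith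
    moreover have "0 \<le> s" using 3(2) qq q by simp
    ultimately show thesis using that[of s r t] 3 small[of s r t] by (simp add: algebra_simps)
  next
    case (5 t)
    have "(q + 1) * (q\<^sup>2 - 1) = q ^ 3 + (q\<^sup>2 - q - 1)"
      by (simp add: algebra_simps power2_eq_square power3_eq_cube)
    then have "q ^ 3 \<le> (q + 1) * (q\<^sup>2 - 1)" using qq q by simp
    then have "m * q ^ 3 \<le> m * ((q + 1) * (q\<^sup>2 - 1))" using m0 by (intro mult_left_mono) auto
    then have "q ^ 3 * m \<le> m * (q + 1) * (q\<^sup>2 - 1)" by (simp only: mult_ac)
    then have "q ^ 3 * t \<le> m * (q + 1) * (q\<^sup>2 - 1)" using q3t[OF 5(3)] by linarith
    then show thesis using that[of "q\<^sup>2 - 1" 0 t] 5 qq q \<open>0 < q ^ 3\<close> by (simp add: algebra_simps)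
  next
    case (6 r t)
    have "q * r \<le> q * (q - 2)" using 6 q by (intro mult_left_mono) auto
    moreover have "q * (q - 2) + q ^ 3 = (q + 1) * (q\<^sup>2 - 1) - (q - 1)"
      by (simp add: algebra_simps power2_eq_square power3_eq_cube)
    ultimately have "q * r + q ^ 3 \<le> (q + 1) * (q\<^sup>2 - 1)" using q by linarith
    then have "m * (q * r + q ^ 3) \<le> m * ((q + 1) * (q\<^sup>2 - 1))" using m0 by (intro mult_left_mono) auto
    then have "m * q * r + q ^ 3 * m \<le> m * (q + 1) * (q\<^sup>2 - 1)"
      by (simp only: distrib_left[of m "q * r" "q ^ 3"] mult_ac)
    then have "m * q * r + q ^ 3 * t \<le> m * (q + 1) * (q\<^sup>2 - 1)" using q3t[OF 6(5)] by linarith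
    then show thesis using that[of "q\<^sup>2 - 1" r t] 6 full[of r t] qq q by (simp add: algebra_simps)
  next
    case (7 r t)
    have "m * q * r + q ^ 3 * t \<le> m * (q + 1) * (q\<^sup>2 - 1)" using T[of t "q\<^sup>2 - 1" r] 7 qq q by simp
    then show thesis using that[of "q\<^sup>2 - 1" r t] 7 full[of r t] qq q by (simp add: algebra_simps)
  qed
qed

text \<open>The upper bound forces \<open>s < q\<^sup>2\<close>, so \<open>GGS_T\<close> describes
  the range of \<open>t\<close>; the families are then told apart by \<open>s\<close> and
  \<open>r\<close>.\<close>

lemma GGS_lists_complete:
  fixes q m s r t :: int
  assumes q: "q \<ge> 2" and n: "n \<ge> 5" "m * (q + 1) = q ^ n + 1"
    and s: "0 \<le> s" and r: "0 \<le> r" "r \<le> q" and t: "0 \<le> t" "t < m"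
    and le: "m * q * r + q ^ 3 * t \<le> m * (q + 1) * s"
    and bound: "m * (q + 1) * s - m * r - t \<le> m * (q + 1) * (q\<^sup>2 - 1) - q ^ 3"
  shows "m * (q + 1) * s - m * r - t \<in>
    GGS_L1 q m \<union> GGS_L2 q m \<union> GGS_L3 q m \<union> GGS_L4 q m \<union> GGS_L5 q m \<union> GGS_L6 q m \<union> GGS_L7 q m"
proof -
  have m0: "0 < m" using t by simp
  have q3: "0 < q ^ 3" using q by simp
  have sq: "s < q\<^sup>2"
  proof (rule ccontr)
    assume "\<not> s < q\<^sup>2"
    then have "m * (q + 1) * q\<^sup>2 \<le> m * (q + 1) * s" using m0 q by (intro mult_left_mono) auto
    moreover have "m * r \<le> m * q" using m0 r by (intro mult_left_mono) auto
    moreover have "m * (q + 1) * (q\<^sup>2 - 1) = m * (q + 1) * q\<^sup>2 - m * q - m"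
      by (simp add: algebra_simps)
    ultimately show False using bound t q3 by linarith
  qed
  have T: "t \<le> GGS_T q m s r" using le_GGS_T_iff[OF q _ n(2) s sq r] n(1) le by simp
  have eq: "m * (q + 1) * s - m * r - t = - t - r * m + m * (q + 1) * s" by (simp add: algebra_simps)
  consider "s \<le> q" | "q + 1 \<le> s" "s \<le> q\<^sup>2 - q" | "q\<^sup>2 - q + 1 \<le> s" "s \<le> q\<^sup>2 - 2" "r \<le> q + s - q\<^sup>2 - 1"
    | "q\<^sup>2 - q + 1 \<le> s" "s \<le> q\<^sup>2 - 2" "q + s - q\<^sup>2 \<le> r" | "s = q\<^sup>2 - 1" "r = 0"
    | "s = q\<^sup>2 - 1" "1 \<le> r" "r \<le> q - 2" | "s = q\<^sup>2 - 1" "q - 1 \<le> r"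
    using sq r by linarith
  then show ?thesis
  proof cases
    case 1
    \<comment> \<open>Otherwise \<open>(q + 1) * s < q * r\<close>, which contradicts the inequality
      even for \<open>t = 0\<close>.\<close>
    have "r \<le> s"
    proof (rule ccontr)
      assume "\<not> r \<le> s"
      then have "q * (s + 1) \<le> q * r" using q by (intro mult_left_mono) auto
      moreover have "s < q" using \<open>\<not> r \<le> s\<close> r(2) by simp
      ultimately have "(q + 1) * s < q * r" by (simp add: algebra_simps)
      then have "m * ((q + 1) * s) < m * (q * r)" using m0 by simp
      moreover have "0 \<le> q ^ 3 * t" using q3 t by simp
      ultimately show False using le by (simp add: mult.assoc)
    qed
    have "- t - r * m + m * (q + 1) * s \<in> GGS_L1 q m"
      unfolding GGS_L1_def by (intro CollectI exI[of _ s] exI[of _ r] exI[of _ t]) (use \<open>r \<le> s\<close> 1 s r t T in auto)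
    then show ?thesis unfolding eq by blast
  next
    case 2
    have "- t - r * m + m * (q + 1) * s \<in> GGS_L2 q m"
      unfolding GGS_L2_def by (intro CollectI exI[of _ s] exI[of _ r] exI[of _ t]) (use 2 s r t T in auto)
    then show ?thesis unfolding eq by blast
  next
    case 3
    have "- t - r * m + m * (q + 1) * s \<in> GGS_L3 q m"
      unfolding GGS_L3_def by (intro CollectI exI[of _ s] exI[of _ r] exI[of _ t]) (use 3 s r t T in auto)
    then show ?thesis unfolding eq by blast
  next
    case 4
    have "- t - r * m + m * (q + 1) * s \<in> GGS_L4 q m"
      unfolding GGS_L4_def by (intro CollectI exI[of _ s] exI[of _ r] exI[of _ t]) (use 4 s r t T in auto)
    then show ?thesis unfolding eq by blast
  next
    case 5
    \<comment> \<open>With \<open>r = 0\<close> at the top value of \<open>s\<close>, the upper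
      bound says exactly that \<open>t \<ge> q ^ 3\<close>.\<close>
    then have "q ^ 3 \<le> t" using bound by simp
    have "- t - r * m + m * (q + 1) * s \<in> GGS_L5 q m"
      unfolding GGS_L5_def by (intro CollectI exI[of _ t]) (use \<open>q ^ 3 \<le> t\<close> 5 s r t T in auto)
    then show ?thesis unfolding eq by blast
  next
    case 6
    have "- t - r * m + m * (q + 1) * s \<in> GGS_L6 q m"
      unfolding GGS_L6_def by (intro CollectI exI[of _ r] exI[of _ t]) (use 6 s r t T in auto)
    then show ?thesis unfolding eq by blast
  next
    case 7
    have "- t - r * m + m * (q + 1) * s \<in> GGS_L7 q m"
      unfolding GGS_L7_def by (intro CollectI exI[of _ r] exI[of _ t]) (use 7 s r t T in auto)
    then show ?thesis unfolding eq by blast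
  qed
qed

section \<open>Comparison of the list with the pole numbers below \<open>2 * g\<close>\<close>

theorem proposition4p3:
  fixes q n :: nat and m g :: int
    and k :: "'a::field set" and x y z :: 'a and P\<^sub>0 :: "'a \<Rightarrow> int"
  assumes "primepow q" and "odd n" and "n \<ge> 5"
    and "m = (int q ^ n + 1) div (int q + 1)"
    and "g = (int q - 1) * (int q ^ (n + 1) + int q ^ n - int q ^ 2) div 2"
    and "GGS_function_field q n k x y z"
    and "P\<^sub>0 \<in> places k" and "lies_over_origin x y z P\<^sub>0"
  shows "GGS_L1 (int q) m \<union> GGS_L2 (int q) m \<union> GGS_L3 (int q) m \<union> GGS_L4 (int q) m \<union>
         GGS_L5 (int q) m \<union> GGS_L6 (int q) m \<union> GGS_L7 (int q) m
       = weierstrass_semigroup k P\<^sub>0 \<inter> {0..2 * g - 1}"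
    (is "?L = ?R")
proof -
  let ?m = "(q ^ n + 1) div (q + 1)" and ?q = "int q"
  interpret GGS_point q n ?m k x y z P\<^sub>0
    using assms by unfold_locales auto
  have m: "int ?m = m" unfolding assms(4) by (simp add: zdiv_int add.commute)
  have mq: "m * (?q + 1) = ?q ^ n + 1"
    using arg_cong[OF m_mult, of int] unfolding m[symmetric] by (simp add: algebra_simps)
  have q: "?q \<ge> 2" using q_ge by simp
  \<comment> \<open>With \<open>m * (?q + 1) = ?q ^ n + 1\<close> the number
    \<open>2 * g - 1\<close> becomes the bound used for the lists.\<close>
  have "2 * g = (?q - 1) * (?q ^ (n + 1) + ?q ^ n - ?q ^ 2)"
    unfolding assms(5) using GGS_genus_exact[of n ?q] assms(3) by simp
  also have "\<dots> = (?q - 1) * ((?q ^ n + 1) * (?q + 1) - (?q + 1) - ?q ^ 2)"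
    by (simp add: algebra_simps)
  also have "\<dots> = m * (?q + 1) * (?q\<^sup>2 - 1) - ?q ^ 3 + 1"
    unfolding mq[symmetric] by (simp add: algebra_simps power2_eq_square power3_eq_cube)
  finally have g: "2 * g - 1 = m * (?q + 1) * (?q\<^sup>2 - 1) - ?q ^ 3" by simp
  show ?thesis
  proof (intro equalityI subsetI)
    fix N assume "N \<in> ?L"
    then obtain s r t where *: "0 \<le> s" "0 \<le> r" "0 \<le> t" "m * ?q * r + ?q ^ 3 * t \<le> m * (?q + 1) * s"
      "N = m * (?q + 1) * s - m * r - t" "N \<le> m * (?q + 1) * (?q\<^sup>2 - 1) - ?q ^ 3"
      using GGS_lists_sound[OF q assms(3) mq] by metis
    obtain s' r' t' where nat: "s = int s'" "r = int r'" "t = int t'"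
      using *(1-3) by (metis nonneg_int_cases)
    have "int (?m * q * r' + q ^ 3 * t') \<le> int (?m * (q + 1) * s')"
      using *(4) unfolding nat of_nat_mult of_nat_add of_nat_power m by simp
    then have "?m * q * r' + q ^ 3 * t' \<le> ?m * (q + 1) * s'" by (simp only: of_nat_le_iff)
    from monomial_pole_number[OF this] have "N \<in> weierstrass_semigroup k P\<^sub>0"
      unfolding *(5) nat of_nat_mult of_nat_add m by (simp add: algebra_simps)
    moreover from this have "N \<ge> 0" unfolding weierstrass_semigroup_def by simp
    ultimately show "N \<in> ?R" using *(6) unfolding g by simp
  next
    fix N assume N: "N \<in> ?R"
    then obtain s b c where *: "b \<le> q" "c < ?m" "?m * q * b + q ^ 3 * c \<le> ?m * (q + 1) * s"
      "N = int (?m * (q + 1) * s) - int (?m * b + c)"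
      using pole_number_monomial by blast
    have "int (?m * q * b + q ^ 3 * c) \<le> int (?m * (q + 1) * s)" using *(3) by (simp only: of_nat_le_iff)
    then have le: "m * ?q * int b + ?q ^ 3 * int c \<le> m * (?q + 1) * int s"
      unfolding of_nat_mult of_nat_add of_nat_power m by simp
    have eq: "N = m * (?q + 1) * int s - m * int b - int c"
      unfolding *(4) of_nat_mult of_nat_add m by simp
    have "int c < int ?m" using *(2) by (simp only: of_nat_less_iff)
    then have c: "int c < m" unfolding m .
    show "N \<in> ?L" unfolding eq
      using *(1) c le N unfolding g eq by (intro GGS_lists_complete[OF q assms(3) mq]) auto
  qed
qed

end
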